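(* Fix $0\le D<\infty$. Let $f_n\in\mathscr S(D)$ ($n\ge1$) and set $F_n=\mathscr B[f_n]$. Then $\{F_n\}$ is a normal family in the topology of locally uniform convergence on $\mathbb D$. More precisely, with $$k_D=\tanh\frac{J(D)}2<1,\qquad J(D)=\operatorname{arcsinh}\!\left(\frac{2}{\sqrt3}\sinh\frac D2\right),$$ every $F_n=H_n+\overline{G_n}$ satisfies $\|G_n'/H_n'\|_\infty\le k_D$, and every sequence of the $F_n$ admits a locally uniformly convergent subsequence whose limit is a normalized orientation-preserving univalent harmonic mapping $F$ in $\mathbb D$ (normalized: $F(0)=0$, $F_z(0)=1$) with quasiconformal constant at most $(1+k_D)/(1-k_D)$.
   Context: $\mathbb D$ is the open unit disk in $\mathbb C$. An orientation-preserving harmonic mapping in $\mathbb D$ is a complex-valued harmonic function $f=h+\overline g$, with $h,g$ analytic in $\mathbb D$, whose Jacobian $|h'|^2-|g'|^2$ is positive everywhere; its complex dilatation $\omega_f=g'/h'$ is an analytic map $\mathbb D\to\mathbb D$. Univalent means injective. $\|\cdot\|_\infty$ is the supremum norm on $\mathbb D$. The quasiconformal constant of a univalent $f$ with $\|\omega_f\|_\infty<1$ is $\frac{1+\|\omega_f\|_\infty}{1-\|\omega_f\|_\infty}$. Hyperbolic distance: $d_{\mathbb D}(z_1,z_2)=2\operatorname{arctanh}\left|\frac{z_1-z_2}{1-\overline{z_2}z_1}\right|$. For a nonempty hyperbolically bounded $E\subset\mathbb D$, the infimum over $c\in\mathbb D$ of $\sup_{\zeta\in E}d_{\mathbb D}(c,\zeta)$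 is attained at a unique point, the circumcenter of $E$. For $\|\omega_f\|_\infty<1$, $d_{\mathrm{aff}}(f)$ is the hyperbolic diameter and $c_{\mathrm{aff}}(f)$ the circumcenter of $\overline{\omega_f(\mathbb D)}$. $\mathscr S(D)$ is the class of univalent orientation-preserving harmonic $f:\mathbb D\to\mathbb C$ with $\|\omega_f\|_\infty<1$ and $d_{\mathrm{aff}}(f)\le D$. Canonical balanced representative: $\mathscr B[f](z)=\frac{A(f(z))-A(f(0))}{(A\circ f)_z(0)}$, where $A(w)=aw+b\overline w+c$, $|a|>|b|$, is any orientation-preserving real-affine mapping with $c_{\mathrm{aff}}(A\circ f)=0$; such $A$ exist and $\mathscr B[f]$ does not depend on the choice. *)

theory Defs
  imports "HOL-Complex_Analysis.Complex_Analysis"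
begin

abbreviation unit_disk :: "complex set" where
  "unit_disk \<equiv> ball 0 1"

subsection \<open>Harmonic mappings of the disk\<close>

text \<open>Mappings of the disk are total functions on \<open>\<complex>\<close>, of which only the values on the disk matter.\<close>

definition analytic_parts ::
    "(complex \<Rightarrow> complex) \<Rightarrow> (complex \<Rightarrow> complex) \<Rightarrow> (complex \<Rightarrow> complex) \<Rightarrow> bool" where
  "analytic_parts f h g \<longleftrightarrow>
     h holomorphic_on unit_disk \<and> g holomorphic_on unit_disk \<and>
     (\<forall>z\<in>unit_disk. f z = h z + cnj (g z))"

definition op_harmonic :: "(complex \<Rightarrow> complex) \<Rightarrow> bool" where
  "op_harmonic f \<longleftrightarrow>
     (\<exists>h g. analytic_parts f h g \<and>
            (\<forall>z\<in>unit_disk. (cmod (deriv h z))\<^sup>2 - (cmod (deriv g z))\<^sup>2 > 0))"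

abbreviation univalent :: "(complex \<Rightarrow> complex) \<Rightarrow> bool" where
  "univalent f \<equiv> inj_on f unit_disk"

text \<open>The parts \<open>h\<close> and \<open>g\<close> are unique up to additive constants, so on the disk the quotient
  of their derivatives depends only on \<open>f\<close>.\<close>

definition dilatation :: "(complex \<Rightarrow> complex) \<Rightarrow> complex \<Rightarrow> complex" where
  "dilatation f z = (THE w. \<exists>h g. analytic_parts f h g \<and> w = deriv g z / deriv h z)"

text \<open>A real-valued supremum, hence meaningful only for functions bounded on the disk.
  Dilatations of orientation-preserving harmonic mappings are bounded by 1.\<close>

definition sup_norm :: "(complex \<Rightarrow> complex) \<Rightarrow> real" where
  "sup_norm \<phi> = (SUP z\<in>unit_disk. cmod (\<phi> z))"

definition qc_constant :: "(complex \<Rightarrow> complex) \<Rightarrow> real" where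
  "qc_constant f = (1 + sup_norm (dilatation f)) / (1 - sup_norm (dilatation f))"

text \<open>The Wirtinger derivative \<open>f\<^sub>z = (f\<^sub>x - \<i> f\<^sub>y) / 2\<close>.\<close>

definition wirtinger :: "(complex \<Rightarrow> complex) \<Rightarrow> complex \<Rightarrow> complex" where
  "wirtinger f z =
     (frechet_derivative f (at z) 1 - \<i> * frechet_derivative f (at z) \<i>) / 2"

subsection \<open>Hyperbolic geometry of the disk\<close>

definition hyp_dist :: "complex \<Rightarrow> complex \<Rightarrow> real" where
  "hyp_dist z1 z2 = 2 * artanh (cmod ((z1 - z2) / (1 - cnj z2 * z1)))"

text \<open>The suprema below are meaningful for nonempty hyperbolically bounded subsets of the disk.\<close>

definition hyp_diameter :: "complex set \<Rightarrow> real" where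
  "hyp_diameter E = (SUP (z, w)\<in>E \<times> E. hyp_dist z w)"

definition circumcenter :: "complex set \<Rightarrow> complex" where
  "circumcenter E =
     (THE c. c \<in> unit_disk \<and>
        (SUP \<zeta>\<in>E. hyp_dist c \<zeta>) = (INF c'\<in>unit_disk. SUP \<zeta>\<in>E. hyp_dist c' \<zeta>))"

definition d_aff :: "(complex \<Rightarrow> complex) \<Rightarrow> real" where
  "d_aff f = hyp_diameter (closure (dilatation f ` unit_disk))"

definition c_aff :: "(complex \<Rightarrow> complex) \<Rightarrow> complex" where
  "c_aff f = circumcenter (closure (dilatation f ` unit_disk))"

subsection \<open>The class of mappings and the canonical balanced representative\<close>

definition harmonic_class :: "real \<Rightarrow> (complex \<Rightarrow> complex) set" where
  "harmonic_class D =
     {f. op_harmonic f \<and> univalent f \<and> sup_norm (dilatation f) < 1 \<and> d_aff f \<le> D}"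

definition op_real_affine :: "(complex \<Rightarrow> complex) \<Rightarrow> bool" where
  "op_real_affine A \<longleftrightarrow>
     (\<exists>a b c. cmod a > cmod b \<and> A = (\<lambda>w. a * w + b * cnj w + c))"

definition balanced_rep :: "(complex \<Rightarrow> complex) \<Rightarrow> complex \<Rightarrow> complex" where
  "balanced_rep f =
     (let A = (SOME A. op_real_affine A \<and> c_aff (A \<circ> f) = 0)
      in (\<lambda>z. (A (f z) - A (f 0)) / wirtinger (A \<circ> f) 0))"

definition J_const :: "real \<Rightarrow> real" where
  "J_const D = arsinh (2 / sqrt 3 * sinh (D / 2))"

definition k_const :: "real \<Rightarrow> real" where
  "k_const D = tanh (J_const D / 2)"

subsection \<open>Locally uniform convergence and normal families\<close>

definition locally_uniform_limit ::
    "complex set \<Rightarrow> (nat \<Rightarrow> complex \<Rightarrow> complex) \<Rightarrow> (complex \<Rightarrow> complex) \<Rightarrow> bool" where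
  "locally_uniform_limit S u l \<longleftrightarrow>
     (\<forall>x\<in>S. \<exists>e>0. uniform_limit (ball x e \<inter> S) u l sequentially)"

definition normal_family :: "complex set \<Rightarrow> (complex \<Rightarrow> complex) set \<Rightarrow> bool" where
  "normal_family S \<F> \<longleftrightarrow>
     (\<forall>s. range s \<subseteq> \<F> \<longrightarrow>
        (\<exists>r l. strict_mono (r :: nat \<Rightarrow> nat) \<and> locally_uniform_limit S (\<lambda>m. s (r m)) l))"

end

theory Submission
  imports Defs "HOL-Library.Diagonal_Subsequence" "HOL-Real_Asymp.Real_Asymp"
begin

text \<open>
  Post-composition with an affine mapping changes the dilatation by a Moebius automorphism of the
  disk, hence by a hyperbolic isometry, so the dilatation of a balanced representative has a range of
  diameter at most \<open>D\<close> with circumcenter \<open>0\<close>. At a circumcenter \<open>0\<close> the farthest points have \<open>0\<close> in their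
  convex hull (otherwise the center could be moved to decrease the radius). Averaging the hyperbolic
  cosines of their mutual distances over at most three of them gives Jung's inequality, which is
  the bound \<open>k\<^sub>D\<close>.

  Compactness is obtained without quasiconformal theory. It suffices to bound \<open>h'' / h'\<close> at \<open>0\<close>
  uniformly over the univalent \<open>h + cnj g\<close> with \<open>\<bar>g'\<bar> \<le> k \<bar>h'\<bar>\<close>. Were this false, rescaling at points
  where \<open>(1/2 - \<bar>z\<bar>) \<bar>h'' / h'\<bar>\<close> is maximal would produce in the limit a univalent \<open>h + cnj g\<close> on the
  whole plane with \<open>h''(0) \<noteq> 0\<close>. Its dilatation is constant by Liouville's theorem, so that \<open>h\<close> itself is
  injective and entire, hence affine, a contradiction. Univalence survives the limits because, by
  Brouwer's theorem, nearby mappings attain each value that the limit takes with invertible derivative.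
\<close>

subsection \<open>Jung's inequality in the hyperbolic plane\<close>

lemma pseudo_hyperbolic_identity:
  "(cmod (1 - cnj w * z))\<^sup>2 = (cmod (z - w))\<^sup>2 + (1 - (cmod z)\<^sup>2) * (1 - (cmod w)\<^sup>2)"
  unfolding cmod_power2 by (simp add: algebra_simps power2_eq_square)

lemma one_minus_norm_square_pos: "z \<in> unit_disk \<Longrightarrow> 0 < 1 - (cmod z)\<^sup>2"
  by (simp add: power_less_one_iff)

text \<open>On the disk this is the hyperbolic cosine of \<open>hyp_dist\<close>. Being rational in
  the coordinates, it turns comparisons of distances into polynomial inequalities.\<close>

definition cosh_dist :: "complex \<Rightarrow> complex \<Rightarrow> real" where
  "cosh_dist z w = 1 + 2 * (cmod (z - w))\<^sup>2 / ((1 - (cmod z)\<^sup>2) * (1 - (cmod w)\<^sup>2))"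

lemma cosh_hyp_dist:
  assumes "z \<in> unit_disk" "w \<in> unit_disk"
  shows "cosh (hyp_dist z w) = cosh_dist z w" "0 \<le> hyp_dist z w"
proof -
  define p where "p = (1 - (cmod z)\<^sup>2) * (1 - (cmod w)\<^sup>2)"
  have p: "p > 0"
    using assms[THEN one_minus_norm_square_pos] by (simp add: p_def)
  define \<delta> where "\<delta> = cmod ((z - w) / (1 - cnj w * z))"
  define m where "m = (cmod (z - w))\<^sup>2"
  have m: "m \<ge> 0" by (simp add: m_def)
  \<comment> \<open>By \<open>pseudo_hyperbolic_identity\<close> the squared modulus of the
    denominator of \<open>\<delta>\<close> is \<open>m + p\<close>. This gives both
    \<open>\<delta> < 1\<close> and the closed form of
    \<open>(1 + \<delta>\<^sup>2) / (1 - \<delta>\<^sup>2)\<close>, which is the hyperbolic cosine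
    of \<open>2 * artanh \<delta>\<close>.\<close>
  have \<delta>2: "\<delta>\<^sup>2 = m / (m + p)"
    by (simp add: \<delta>_def m_def p_def norm_divide power_divide pseudo_hyperbolic_identity)
  have "\<delta>\<^sup>2 < 1" using m p by (simp add: \<delta>2)
  then have \<delta>: "0 \<le> \<delta>" "\<delta> < 1"
    by (auto simp: \<delta>_def power_less_one_iff)
  have d: "hyp_dist z w = ln ((1 + \<delta>) / (1 - \<delta>))"
    using \<delta> by (simp add: hyp_dist_def artanh_def flip: \<delta>_def)
  show "0 \<le> hyp_dist z w" using \<delta> by (simp add: d ln_ge_zero)
  have "cosh (hyp_dist z w) = ((1 + \<delta>) / (1 - \<delta>) + (1 - \<delta>) / (1 + \<delta>)) / 2"
    using \<delta> by (simp add: d cosh_ln_real)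
  also have "\<dots> = (1 + \<delta>\<^sup>2) / (1 - \<delta>\<^sup>2)"
  proof -
    have "(1 + \<delta>) / (1 - \<delta>) + (1 - \<delta>) / (1 + \<delta>)
        = ((1 + \<delta>) * (1 + \<delta>) + (1 - \<delta>) * (1 - \<delta>)) / ((1 - \<delta>) * (1 + \<delta>))"
      using \<delta> by (intro add_frac_eq) auto
    also have "\<dots> = 2 * (1 + \<delta>\<^sup>2) / (1 - \<delta>\<^sup>2)"
      by (rule arg_cong2[where f = "(/)"]) (simp_all add: algebra_simps power2_eq_square)
    finally have "(1 + \<delta>) / (1 - \<delta>) + (1 - \<delta>) / (1 + \<delta>) = 2 * ((1 + \<delta>\<^sup>2) / (1 - \<delta>\<^sup>2))"
      by (simp only: times_divide_eq_right)
    then show ?thesis by (simp only: nonzero_mult_div_cancel_left zero_neq_numeral not_False_eq_True)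
  qed
  also have "\<dots> = 1 + 2 * m / p"
  proof -
    have "1 + \<delta>\<^sup>2 = (p + 2 * m) / (m + p)" "1 - \<delta>\<^sup>2 = p / (m + p)"
      using m p by (simp_all add: \<delta>2 field_simps)
    moreover have "m + p \<noteq> 0" using m p by simp
    ultimately have "(1 + \<delta>\<^sup>2) / (1 - \<delta>\<^sup>2) = (p + 2 * m) / p" by (simp only: divide_divide_times_eq) (simp add: mult.commute)
    also have "\<dots> = 1 + 2 * m / p" using p by (simp add: add_divide_distrib)
    finally show ?thesis .
  qed
  finally show "cosh (hyp_dist z w) = cosh_dist z w"
    by (simp add: cosh_dist_def m_def p_def)
qed

lemma hyp_dist_le_iff:
  assumes "z \<in> unit_disk" "w \<in> unit_disk" "0 \<le> r"
  shows "hyp_dist z w \<le> r \<longleftrightarrow> cosh_dist z w \<le> cosh r"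
  using cosh_hyp_dist[OF assms(1,2)] cosh_real_nonneg_le_iff[OF _ assms(3)] by metis

text \<open>For points of fixed modulus this form is affine in the inner product, so it can be
  averaged with convex weights and shows the first-order effect of moving a center.\<close>

lemma cosh_dist_inner:
  assumes "z \<in> unit_disk" "w \<in> unit_disk"
  shows "cosh_dist z w = ((1 + (cmod z)\<^sup>2) * (1 + (cmod w)\<^sup>2) - 4 * (z \<bullet> w)) /
           ((1 - (cmod z)\<^sup>2) * (1 - (cmod w)\<^sup>2))"
proof -
  have m: "(cmod (z - w))\<^sup>2 = (cmod z)\<^sup>2 + (cmod w)\<^sup>2 - 2 * (z \<bullet> w)"
    unfolding cmod_power2 inner_complex_def by (simp add: algebra_simps power2_eq_square)
  define p where "p = (1 - (cmod z)\<^sup>2) * (1 - (cmod w)\<^sup>2)"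
  have p: "p > 0"
    using assms[THEN one_minus_norm_square_pos] by (simp add: p_def)
  have "cosh_dist z w = (p + 2 * (cmod (z - w))\<^sup>2) / p"
    using p by (simp add: cosh_dist_def add_divide_distrib flip: p_def)
  also have "p + 2 * (cmod (z - w))\<^sup>2 = (1 + (cmod z)\<^sup>2) * (1 + (cmod w)\<^sup>2) - 4 * (z \<bullet> w)"
    by (simp add: m p_def algebra_simps)
  finally show ?thesis by (simp add: p_def)
qed

text \<open>With the denominator cleared, the inequality passes to limits even when a point tends to
  the unit circle.\<close>

lemma cosh_dist_le_iff:
  assumes "z \<in> unit_disk" "w \<in> unit_disk"
  shows "cosh_dist z w \<le> r \<longleftrightarrow>
    2 * (cmod (z - w))\<^sup>2 \<le> (r - 1) * ((1 - (cmod z)\<^sup>2) * (1 - (cmod w)\<^sup>2))"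
proof -
  have "0 < (1 - (cmod z)\<^sup>2) * (1 - (cmod w)\<^sup>2)"
    using assms[THEN one_minus_norm_square_pos] by simp
  from pos_divide_le_eq[OF this] show ?thesis
    unfolding cosh_dist_def by (metis add.commute le_diff_eq)
qed

text \<open>Monotonicity of t -> (1 + t) / (1 - t). It serves for distances from 0, with t a squared
  modulus, and for the quasiconformal constant, with t a supremum norm.\<close>

lemma one_plus_div_one_minus_le_iff:
  fixes a b :: real
  assumes "a < 1" "b < 1"
  shows "(1 + a) / (1 - a) \<le> (1 + b) / (1 - b) \<longleftrightarrow> a \<le> b"
proof -
  have "(1 + a) / (1 - a) \<le> (1 + b) / (1 - b) \<longleftrightarrow> (1 + a) * (1 - b) \<le> (1 + b) * (1 - a)"
    using assms by (simp add: pos_divide_le_eq pos_le_divide_eq)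
  then show ?thesis by (simp add: algebra_simps)
qed

lemma cosh_dist_0: "z \<in> unit_disk \<Longrightarrow> cosh_dist 0 z = (1 + (cmod z)\<^sup>2) / (1 - (cmod z)\<^sup>2)"
  by (simp add: cosh_dist_inner)

lemma continuous_on_cosh_dist [continuous_intros]:
  assumes "continuous_on S f" "continuous_on S g"
    and "\<And>x. x \<in> S \<Longrightarrow> f x \<in> unit_disk" "\<And>x. x \<in> S \<Longrightarrow> g x \<in> unit_disk"
  shows "continuous_on S (\<lambda>x. cosh_dist (f x) (g x))"
proof -
  have "(1 - (cmod (f x))\<^sup>2) * (1 - (cmod (g x))\<^sup>2) \<noteq> 0" if "x \<in> S" for x
    using one_minus_norm_square_pos[OF assms(3)[OF that]] one_minus_norm_square_pos[OF assms(4)[OF that]]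
    by simp
  then show ?thesis
    unfolding cosh_dist_def using assms(1,2) by (intro continuous_intros) auto
qed

section \<open>Hyperbolic radii and the existence of circumcenters\<close>

definition hyp_radius :: "complex set \<Rightarrow> complex \<Rightarrow> real" where
  "hyp_radius E c = (SUP \<zeta>\<in>E. hyp_dist c \<zeta>)"

text \<open>Continuity of \<open>cosh_dist\<close> on a compact set gives a maximum, and the
  hyperbolic cosine is increasing on nonnegative distances. The real supremum is thereby known to be
  a genuine one.\<close>

lemma hyp_radius_attained:
  assumes "compact E" "E \<noteq> {}" "E \<subseteq> unit_disk" "c \<in> unit_disk"
  obtains \<zeta> where "\<zeta> \<in> E" "hyp_radius E c = hyp_dist c \<zeta>" "\<And>\<xi>. \<xi> \<in> E \<Longrightarrow> hyp_dist c \<xi> \<le> hyp_dist c \<zeta>"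
proof -
  have "continuous_on E (cosh_dist c)"
    using assms by (intro continuous_intros) auto
  then obtain \<zeta> where \<zeta>: "\<zeta> \<in> E" "\<And>\<xi>. \<xi> \<in> E \<Longrightarrow> cosh_dist c \<xi> \<le> cosh_dist c \<zeta>"
    using continuous_attains_sup[OF assms(1,2)] by blast
  have le: "hyp_dist c \<xi> \<le> hyp_dist c \<zeta>" if "\<xi> \<in> E" for \<xi>
  proof -
    have "\<xi> \<in> unit_disk" "\<zeta> \<in> unit_disk" using that \<zeta>(1) assms(3) by blast+
    then show ?thesis
      using hyp_dist_le_iff[OF assms(4) _ cosh_hyp_dist(2)[OF assms(4)]] cosh_hyp_dist(1)[OF assms(4)] \<zeta>(2)[OF that]
      by simp
  qed
  have "hyp_radius E c = hyp_dist c \<zeta>"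
    unfolding hyp_radius_def by (rule cSup_eq_maximum) (use \<zeta>(1) le in auto)
  with \<zeta>(1) show ?thesis using le by (rule that)
qed

lemma hyp_radius_le_iff:
  assumes "compact E" "E \<noteq> {}" "E \<subseteq> unit_disk" "c \<in> unit_disk"
  shows "hyp_radius E c \<le> r \<longleftrightarrow> (\<forall>\<zeta>\<in>E. hyp_dist c \<zeta> \<le> r)"
proof -
  obtain \<zeta> where "\<zeta> \<in> E" "hyp_radius E c = hyp_dist c \<zeta>" "\<And>\<xi>. \<xi> \<in> E \<Longrightarrow> hyp_dist c \<xi> \<le> hyp_dist c \<zeta>"
    by (rule hyp_radius_attained[OF assms]) blast
  then show ?thesis by (auto intro: order_trans)
qed

lemma hyp_radius_nonneg:
  assumes "compact E" "E \<noteq> {}" "E \<subseteq> unit_disk" "c \<in> unit_disk"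
  shows "0 \<le> hyp_radius E c"
proof -
  obtain \<zeta> where "\<zeta> \<in> E" "hyp_radius E c = hyp_dist c \<zeta>"
    by (rule hyp_radius_attained[OF assms]) blast
  then show ?thesis using cosh_hyp_dist(2)[OF assms(4)] assms(3) by (simp add: subset_iff)
qed

text \<open>Minimality is stated by comparison, without an infimum and without uniqueness, so that
  it transfers easily along isometries. \<open>is_circumcenter_iff_Inf\<close> links it to
  \<open>circumcenter\<close>.\<close>

definition is_circumcenter :: "complex set \<Rightarrow> complex \<Rightarrow> bool" where
  "is_circumcenter E c \<longleftrightarrow> c \<in> unit_disk \<and> (\<forall>c'\<in>unit_disk. hyp_radius E c \<le> hyp_radius E c')"

lemma is_circumcenter_iff_Inf:
  assumes "compact E" "E \<noteq> {}" "E \<subseteq> unit_disk"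
  shows "is_circumcenter E c \<longleftrightarrow>
    c \<in> unit_disk \<and> hyp_radius E c = (INF c'\<in>unit_disk. hyp_radius E c')"
proof -
  have bdd: "bdd_below (hyp_radius E ` unit_disk)"
    using hyp_radius_nonneg[OF assms] by (intro bdd_belowI[of _ 0]) auto
  show ?thesis
  proof (intro iffI conjI)
    assume c: "is_circumcenter E c"
    then show "c \<in> unit_disk" by (simp add: is_circumcenter_def)
    with c show "hyp_radius E c = (INF c'\<in>unit_disk. hyp_radius E c')"
      by (intro cInf_eq_minimum[symmetric]) (auto simp: is_circumcenter_def)
  next
    assume "c \<in> unit_disk \<and> hyp_radius E c = (INF c'\<in>unit_disk. hyp_radius E c')"
    then show "is_circumcenter E c"
      using cINF_lower[OF bdd] by (auto simp: is_circumcenter_def)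
  qed
qed

text \<open>A minimizing sequence of centers has a limit in the closed disk. The inequalities with
  cleared denominators survive the limit; they keep it off the unit circle and show that it is a
  minimizer.\<close>

lemma ex_circumcenter:
  assumes E: "compact E" "E \<noteq> {}" "E \<subseteq> unit_disk"
  shows "\<exists>c. is_circumcenter E c"
proof -
  define m where "m = (INF c\<in>unit_disk. hyp_radius E c)"
  have m0: "0 \<le> m"
    unfolding m_def by (rule cINF_greatest) (auto intro: hyp_radius_nonneg[OF E])
  have "\<exists>c\<in>unit_disk. hyp_radius E c < m + 1 / real (Suc n)" for n
  proof -
    have "\<exists>x\<in>hyp_radius E ` unit_disk. x < m + 1 / real (Suc n)"
      unfolding m_def by (rule cInf_lessD) auto
    then show ?thesis by blast
  qed
  then obtain c where c: "\<And>n. c n \<in> unit_disk" "\<And>n. hyp_radius E (c n) < m + 1 / real (Suc n)"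
    by metis
  have bound: "2 * (cmod (c n - \<zeta>))\<^sup>2 \<le>
      (cosh (m + 1 / real (Suc n)) - 1) * ((1 - (cmod (c n))\<^sup>2) * (1 - (cmod \<zeta>)\<^sup>2))" if "\<zeta> \<in> E" for n \<zeta>
  proof -
    have \<zeta>: "\<zeta> \<in> unit_disk" using that E by blast
    have "hyp_dist (c n) \<zeta> \<le> m + 1 / real (Suc n)"
      using hyp_radius_le_iff[OF E c(1)] c(2) that less_imp_le by blast
    then have "cosh_dist (c n) \<zeta> \<le> cosh (m + 1 / real (Suc n))"
      using hyp_dist_le_iff[OF c(1) \<zeta>] m0 by simp
    then show ?thesis
      unfolding cosh_dist_le_iff[OF c(1) \<zeta>] .
  qed
  have "\<forall>n. c n \<in> cball 0 1" using c(1) by (simp add: less_imp_le)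
  then obtain l r where l: "l \<in> cball 0 1" and r: "strict_mono (r :: nat \<Rightarrow> nat)" "(c \<circ> r) \<longlonglongrightarrow> l"
    using compact_imp_seq_compact[OF compact_cball] by (metis seq_compactE)
  have lim: "(\<lambda>n. c (r n)) \<longlonglongrightarrow> l" using r(2) by (simp add: o_def)
  have "(\<lambda>n. m + 1 / real (Suc n)) \<longlonglongrightarrow> m + 0"
    by (intro tendsto_intros LIMSEQ_inverse_real_of_nat[unfolded inverse_eq_divide])
  then have "(\<lambda>n. m + 1 / real (Suc (r n))) \<longlonglongrightarrow> m"
    using filterlim_compose[OF _ filterlim_subseq[OF r(1)]] by simp
  then have lim': "(\<lambda>n. cosh (m + 1 / real (Suc (r n)))) \<longlonglongrightarrow> cosh m"
    by (intro tendsto_intros)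
  have bound': "2 * (cmod (l - \<zeta>))\<^sup>2 \<le> (cosh m - 1) * ((1 - (cmod l)\<^sup>2) * (1 - (cmod \<zeta>)\<^sup>2))"
    if "\<zeta> \<in> E" for \<zeta>
  proof (rule tendsto_le[OF sequentially_bot])
    show "(\<lambda>n. 2 * (cmod (c (r n) - \<zeta>))\<^sup>2) \<longlonglongrightarrow> 2 * (cmod (l - \<zeta>))\<^sup>2"
      by (intro tendsto_intros lim)
    show "(\<lambda>n. (cosh (m + 1 / real (Suc (r n))) - 1) * ((1 - (cmod (c (r n)))\<^sup>2) * (1 - (cmod \<zeta>)\<^sup>2)))
        \<longlonglongrightarrow> (cosh m - 1) * ((1 - (cmod l)\<^sup>2) * (1 - (cmod \<zeta>)\<^sup>2))"
      by (intro tendsto_intros lim lim')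
  qed (use bound[OF that] in auto)
  have l1: "l \<in> unit_disk"
  proof (rule ccontr)
    assume "l \<notin> unit_disk"
    with l have l1: "cmod l = 1" by simp
    \<comment> \<open>For \<open>cmod l = 1\<close> the right-hand side of \<open>bound'\<close>
      vanishes, so \<open>l\<close> would equal a point of \<open>E\<close>, which lies inside the
      open disk.\<close>
    obtain \<zeta> where \<zeta>: "\<zeta> \<in> E" using E(2) by blast
    have "l = \<zeta>" using bound'[OF \<zeta>] l1 by simp
    with \<zeta> l1 E(3) show False by auto
  qed
  have "hyp_radius E l \<le> m"
    unfolding hyp_radius_le_iff[OF E l1]
  proof
    fix \<zeta> assume \<zeta>: "\<zeta> \<in> E"
    have \<zeta>': "\<zeta> \<in> unit_disk" using \<zeta> E by blast
    have "cosh_dist l \<zeta> \<le> cosh m"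
      unfolding cosh_dist_le_iff[OF l1 \<zeta>'] by (rule bound'[OF \<zeta>])
    then show "hyp_dist l \<zeta> \<le> m"
      using hyp_dist_le_iff[OF l1 \<zeta>' m0] by simp
  qed
  moreover have "bdd_below (hyp_radius E ` unit_disk)"
    using hyp_radius_nonneg[OF E] by (intro bdd_belowI[of _ 0]) auto
  then have "m \<le> hyp_radius E c'" if "c' \<in> unit_disk" for c'
    unfolding m_def by (rule cINF_lower) fact
  ultimately have "is_circumcenter E l"
    using l1 by (auto simp: is_circumcenter_def intro: order_trans)
  then show ?thesis by blast
qed

section \<open>Sets with circumcenter 0 and Jung's inequality\<close>

text \<open>Otherwise a line separates 0 from the farthest points, and all of them have positive
  inner product with some \<open>v\<close>. Moving the center by a small multiple of
  \<open>v\<close> gains to first order and costs only to second order, which contradicts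
  minimality. The argument runs along centers tending to 0 and a limit of their farthest
  points.\<close>

lemma circumcenter_0_convex_hull:
  assumes E: "compact E" "E \<noteq> {}" "E \<subseteq> unit_disk" and circ: "is_circumcenter E 0"
    and \<rho>: "\<xi> \<in> E" "cmod \<xi> = \<rho>" "\<And>\<zeta>. \<zeta> \<in> E \<Longrightarrow> cmod \<zeta> \<le> \<rho>"
  shows "0 \<in> convex hull {\<zeta>\<in>E. cmod \<zeta> = \<rho>}"
proof (rule ccontr)
  let ?K = "{\<zeta>\<in>E. cmod \<zeta> = \<rho>}"
  assume "0 \<notin> convex hull ?K"
  moreover have "?K = E \<inter> sphere 0 \<rho>" by auto
  then have "compact ?K" using E(1) by (simp add: compact_Int)
  then have "closed (convex hull ?K)" by (intro compact_imp_closed compact_convex_hull)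
  ultimately obtain a b where ab: "a \<noteq> 0" "0 < b" "\<And>x. x \<in> convex hull ?K \<Longrightarrow> b < a \<bullet> x"
    using separating_hyperplane_closed_0[OF convex_convex_hull] by metis
  \<comment> \<open>Length 1/2 keeps every \<open>\<epsilon> n *\<^sub>R v\<close> in the disk and
    makes \<open>e = (\<epsilon> n)\<^sup>2 / 4\<close> below.\<close>
  define v where "v = a /\<^sub>R (2 * cmod a)"
  have v: "cmod v = 1 / 2" using ab(1) by (simp add: v_def)
  have vpos: "v \<bullet> x > 0" if "x \<in> ?K" for x
    using ab(1,2) ab(3)[OF hull_inc[OF that]] by (simp add: v_def)
  define \<epsilon> where "\<epsilon> = (\<lambda>n. 1 / real (Suc n))"
  have \<epsilon>: "0 < \<epsilon> n" "\<epsilon> n \<le> 1" for n by (auto simp: \<epsilon>_def)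
  have \<epsilon>0: "\<epsilon> \<longlonglongrightarrow> 0"
    unfolding \<epsilon>_def by (rule LIMSEQ_inverse_real_of_nat[unfolded inverse_eq_divide])
  define c where "c = (\<lambda>n. \<epsilon> n *\<^sub>R v)"
  have c: "c n \<in> unit_disk" for n
    using \<epsilon>[of n] by (simp add: c_def v)
  have z0: "(0::complex) \<in> unit_disk" by simp
  have \<rho>1: "0 \<le> \<rho>" "\<rho> < 1" using \<rho>(1,2) E(3) by auto
  \<comment> \<open>A point of \<open>E\<close> farthest from \<open>c n\<close> qualifies, since
    the radius about \<open>c n\<close> is at least the radius about the circumcenter 0.\<close>
  have "\<exists>\<zeta>\<in>E. cosh_dist 0 \<xi> \<le> cosh_dist (c n) \<zeta>" for n
  proof -
    obtain \<zeta> where \<zeta>: "\<zeta> \<in> E" "hyp_radius E (c n) = hyp_dist (c n) \<zeta>"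
      using hyp_radius_attained[OF E c] by metis
    have "hyp_dist 0 \<xi> \<le> hyp_radius E 0"
      using hyp_radius_le_iff[OF E z0] \<rho>(1) by blast
    also have "\<dots> \<le> hyp_dist (c n) \<zeta>"
      using circ c \<zeta>(2) by (metis is_circumcenter_def)
    finally have "cosh_dist 0 \<xi> \<le> cosh (hyp_dist (c n) \<zeta>)"
      using hyp_dist_le_iff[OF z0] cosh_hyp_dist(2) c \<zeta>(1) \<rho>(1) E(3) by blast
    also have "\<dots> = cosh_dist (c n) \<zeta>"
      using cosh_hyp_dist(1)[OF c] \<zeta>(1) E(3) by blast
    finally show ?thesis using \<zeta>(1) by blast
  qed
  then obtain \<zeta> where \<zeta>: "\<And>n. \<zeta> n \<in> E" "\<And>n. cosh_dist 0 \<xi> \<le> cosh_dist (c n) (\<zeta> n)"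
    by metis
  have \<zeta>1: "\<zeta> n \<in> unit_disk" for n using \<zeta>(1) E(3) by blast
  have \<xi>1: "\<xi> \<in> unit_disk" using \<rho>(1) E(3) by blast
  obtain l r where l: "l \<in> E" and r: "strict_mono (r :: nat \<Rightarrow> nat)" "(\<zeta> \<circ> r) \<longlonglongrightarrow> l"
    using compact_imp_seq_compact[OF E(1)] \<zeta>(1) by (metis seq_compactE)
  have lim: "(\<lambda>n. \<zeta> (r n)) \<longlonglongrightarrow> l" using r(2) by (simp add: o_def)
  have l1: "l \<in> unit_disk" using l E by blast
  have \<epsilon>r: "(\<lambda>n. \<epsilon> (r n)) \<longlonglongrightarrow> 0"
    by (rule filterlim_compose[OF \<epsilon>0 filterlim_subseq[OF r(1)]])
  have cr: "(\<lambda>n. c (r n)) \<longlonglongrightarrow> 0"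
    unfolding c_def by (rule tendsto_eq_intros \<epsilon>r refl | simp)+
  have "(\<lambda>n. cosh_dist (c (r n)) (\<zeta> (r n))) \<longlonglongrightarrow> cosh_dist 0 l"
    unfolding cosh_dist_def
    by (intro tendsto_intros cr lim) (use one_minus_norm_square_pos[OF l1] in auto)
  then have "cosh_dist 0 \<xi> \<le> cosh_dist 0 l"
    by (rule tendsto_lowerbound) (use \<zeta>(2) in auto)
  then have "(1 + \<rho>\<^sup>2) / (1 - \<rho>\<^sup>2) \<le> (1 + (cmod l)\<^sup>2) / (1 - (cmod l)\<^sup>2)"
    unfolding cosh_dist_0[OF \<xi>1] cosh_dist_0[OF l1] \<rho>(2) .
  then have "\<rho>\<^sup>2 \<le> (cmod l)\<^sup>2"
    using one_minus_norm_square_pos[OF l1] one_minus_norm_square_pos[OF \<xi>1] \<rho>(2)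
    by (simp add: one_plus_div_one_minus_le_iff)
  then have "\<rho> \<le> cmod l" by (rule power2_le_imp_le) simp
  with \<rho>(3)[OF l] l have "l \<in> ?K" by simp
  then have "v \<bullet> l > 0" by (rule vpos)
  moreover have "v \<bullet> l \<le> 0"
  proof (rule tendsto_le[OF sequentially_bot])
    show "(\<lambda>n. v \<bullet> \<zeta> (r n)) \<longlonglongrightarrow> v \<bullet> l" by (intro tendsto_intros lim)
    show "(\<lambda>n. \<epsilon> (r n)) \<longlonglongrightarrow> 0" by (rule \<epsilon>r)
    \<comment> \<open>Since \<open>s\<close> is at most \<open>\<rho>\<^sup>2\<close>, the point
      \<open>\<zeta> n\<close> is no farther from \<open>c n\<close> than from 0 only if this inner
      product is large; comparing the two values of \<open>cosh_dist\<close> leaves a term of order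
      \<open>\<epsilon> n\<close> against one of order
      \<open>(\<epsilon> n)\<^sup>2\<close>.\<close>
    have "v \<bullet> \<zeta> n \<le> \<epsilon> n" for n
    proof -
      define s where "s = (cmod (\<zeta> n))\<^sup>2"
      define e where "e = (cmod (c n))\<^sup>2"
      have s: "0 \<le> s" "s < 1" "s \<le> \<rho>\<^sup>2"
        using one_minus_norm_square_pos[OF \<zeta>1[of n]] \<rho>(3)[OF \<zeta>(1)[of n]] by (auto simp: s_def power_mono)
      have e: "e < 1" "e = (\<epsilon> n)\<^sup>2 / 4"
        using one_minus_norm_square_pos[OF c[of n]]
        by (simp_all add: e_def c_def power_mult_distrib power_divide v)
      have "(1 + s) / (1 - s) \<le> (1 + \<rho>\<^sup>2) / (1 - \<rho>\<^sup>2)"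
        using s \<rho>1 by (intro frac_le) (auto simp: power_less_one_iff)
      also have "\<dots> \<le> ((1 + e) * (1 + s) - 4 * (c n \<bullet> \<zeta> n)) / ((1 - e) * (1 - s))"
        using \<zeta>(2)[of n] \<rho>(2) cosh_dist_0[OF \<xi>1] cosh_dist_inner[OF c \<zeta>1] by (simp add: s_def e_def)
      finally have "(1 + s) / (1 - s) * ((1 - e) * (1 - s)) \<le> (1 + e) * (1 + s) - 4 * (c n \<bullet> \<zeta> n)"
        using s e(1) by (subst (asm) pos_le_divide_eq) auto
      moreover have "(1 + s) / (1 - s) * ((1 - e) * (1 - s)) = (1 + s) * (1 - e)"
        using s by simp
      ultimately have "(1 + s) * (1 - e) \<le> (1 + e) * (1 + s) - 4 * (c n \<bullet> \<zeta> n)" by simp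
      then have "4 * (\<epsilon> n * (v \<bullet> \<zeta> n)) \<le> 2 * e * (1 + s)"
        by (simp add: c_def algebra_simps)
      also have "\<dots> \<le> 2 * e * 2" using s by (intro mult_left_mono) (auto simp: e_def)
      also have "\<dots> = \<epsilon> n * \<epsilon> n" by (simp add: e power2_eq_square)
      finally have "\<epsilon> n * (4 * (v \<bullet> \<zeta> n)) \<le> \<epsilon> n * \<epsilon> n" by simp
      then have "4 * (v \<bullet> \<zeta> n) \<le> \<epsilon> n" using \<epsilon>(1)[of n] by simp
      with \<epsilon>(1)[of n] show ?thesis by linarith
    qed
    then show "\<forall>\<^sub>F n in sequentially. v \<bullet> \<zeta> (r n) \<le> \<epsilon> (r n)" by simp
  qed
  ultimately show False by simp
qed

text \<open>Distances from 0 increase with the modulus, so the hyperbolically farthest points from 0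
  are the Euclidean ones.\<close>

lemma hyp_radius_0:
  assumes E: "compact E" "E \<noteq> {}" "E \<subseteq> unit_disk"
  obtains \<xi> where "\<xi> \<in> E" "\<And>\<zeta>. \<zeta> \<in> E \<Longrightarrow> cmod \<zeta> \<le> cmod \<xi>"
    "cosh (hyp_radius E 0) = (1 + (cmod \<xi>)\<^sup>2) / (1 - (cmod \<xi>)\<^sup>2)"
proof -
  have z0: "(0::complex) \<in> unit_disk" by simp
  obtain \<xi> where \<xi>: "\<xi> \<in> E" "hyp_radius E 0 = hyp_dist 0 \<xi>"
    "\<And>\<zeta>. \<zeta> \<in> E \<Longrightarrow> hyp_dist 0 \<zeta> \<le> hyp_dist 0 \<xi>"
    using hyp_radius_attained[OF E z0] by metis
  have disk: "\<zeta> \<in> unit_disk" if "\<zeta> \<in> E" for \<zeta> using that E(3) by blast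
  have "cmod \<zeta> \<le> cmod \<xi>" if "\<zeta> \<in> E" for \<zeta>
  proof -
    have "cosh_dist 0 \<zeta> \<le> cosh_dist 0 \<xi>"
      using \<xi>(3)[OF that] hyp_dist_le_iff[OF z0 disk[OF that]] cosh_hyp_dist[OF z0 disk[OF \<xi>(1)]] by metis
    then have "(cmod \<zeta>)\<^sup>2 \<le> (cmod \<xi>)\<^sup>2"
      using one_minus_norm_square_pos[OF disk[OF that]] one_minus_norm_square_pos[OF disk[OF \<xi>(1)]]
      unfolding cosh_dist_0[OF disk[OF that]] cosh_dist_0[OF disk[OF \<xi>(1)]]
      by (simp add: one_plus_div_one_minus_le_iff)
    then show ?thesis by (rule power2_le_imp_le) simp
  qed
  moreover have "cosh (hyp_radius E 0) = (1 + (cmod \<xi>)\<^sup>2) / (1 - (cmod \<xi>)\<^sup>2)"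
    using \<xi>(2) cosh_hyp_dist(1)[OF z0 disk[OF \<xi>(1)]] cosh_dist_0[OF disk[OF \<xi>(1)]] by simp
  ultimately show ?thesis using that \<xi>(1) by blast
qed

text \<open>As 0 lies in the convex hull of the farthest points, these do not all lie in the open
  half-plane towards \<open>w\<close>. A farthest point outside that half-plane is strictly farther
  from \<open>w\<close> than from 0, so \<open>w\<close> has a larger radius.\<close>

lemma circumcenter_0_unique:
  assumes E: "compact E" "E \<noteq> {}" "E \<subseteq> unit_disk" and circ: "is_circumcenter E 0"
    and w: "is_circumcenter E w"
  shows "w = 0"
proof (rule ccontr)
  assume "w \<noteq> 0"
  obtain \<xi> where \<xi>: "\<xi> \<in> E" "\<And>\<zeta>. \<zeta> \<in> E \<Longrightarrow> cmod \<zeta> \<le> cmod \<xi>"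
    "cosh (hyp_radius E 0) = (1 + (cmod \<xi>)\<^sup>2) / (1 - (cmod \<xi>)\<^sup>2)"
    by (rule hyp_radius_0[OF E]) blast
  let ?K = "{\<zeta>\<in>E. cmod \<zeta> = cmod \<xi>}"
  have hull: "0 \<in> convex hull ?K"
    by (rule circumcenter_0_convex_hull[OF E circ \<xi>(1) refl \<xi>(2)])
  have "\<exists>\<zeta>\<in>?K. w \<bullet> \<zeta> \<le> 0"
  proof (rule ccontr)
    assume "\<not> ?thesis"
    then have "?K \<subseteq> {x. 0 < w \<bullet> x}" by (auto simp: not_le)
    then have "convex hull ?K \<subseteq> {x. 0 < w \<bullet> x}"
      by (rule hull_minimal) (rule convex_halfspace_gt)
    with hull show False by auto
  qed
  then obtain \<zeta> where \<zeta>: "\<zeta> \<in> E" "cmod \<zeta> = cmod \<xi>" "w \<bullet> \<zeta> \<le> 0" by auto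
  have w1: "w \<in> unit_disk" and \<zeta>1: "\<zeta> \<in> unit_disk"
    using w \<zeta>(1) E(3) by (auto simp: is_circumcenter_def)
  define s where "s = (cmod \<zeta>)\<^sup>2"
  define e where "e = (cmod w)\<^sup>2"
  have s: "0 \<le> s" "s < 1" and e: "0 < e" "e < 1"
    using one_minus_norm_square_pos[OF \<zeta>1] one_minus_norm_square_pos[OF w1] \<open>w \<noteq> 0\<close>
    by (auto simp: s_def e_def)
  have "hyp_radius E w \<le> hyp_radius E 0" using w by (auto simp: is_circumcenter_def)
  then have "hyp_dist w \<zeta> \<le> hyp_radius E 0"
    using hyp_radius_le_iff[OF E w1] \<zeta>(1) by blast
  then have "cosh_dist w \<zeta> \<le> cosh (hyp_radius E 0)"
    using hyp_dist_le_iff[OF w1 \<zeta>1 hyp_radius_nonneg[OF E]] by simp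
  then have "((1 + e) * (1 + s) - 4 * (w \<bullet> \<zeta>)) / ((1 - e) * (1 - s)) \<le> (1 + s) / (1 - s)"
    using \<xi>(3) \<zeta>(2) cosh_dist_inner[OF w1 \<zeta>1] by (simp add: s_def e_def)
  then have "(1 + e) * (1 + s) - 4 * (w \<bullet> \<zeta>) \<le> (1 + s) / (1 - s) * ((1 - e) * (1 - s))"
    using s e by (subst (asm) pos_divide_le_eq) auto
  also have "\<dots> = (1 + s) * (1 - e)" using s by simp
  finally have "2 * e * (1 + s) \<le> 4 * (w \<bullet> \<zeta>)" by (simp add: algebra_simps)
  moreover have "2 * e * (1 + s) > 0" using s e by simp
  ultimately show False using \<zeta>(3) by linarith
qed

text \<open>Caratheodory's theorem writes 0 as a convex combination of at most three farthest
  points. One weight is at least 1/3, and averaging the hyperbolic cosines of the distances to that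
  point \<open>j\<close> bounds the radius.\<close>

lemma circumcenter_0_Jung:
  assumes E: "compact E" "E \<noteq> {}" "E \<subseteq> unit_disk" and circ: "is_circumcenter E 0"
    and "0 \<le> D" and diam: "\<And>z w. z \<in> E \<Longrightarrow> w \<in> E \<Longrightarrow> hyp_dist z w \<le> D"
  shows "hyp_radius E 0 \<le> J_const D"
proof -
  obtain \<xi> where \<xi>: "\<xi> \<in> E" "\<And>\<zeta>. \<zeta> \<in> E \<Longrightarrow> cmod \<zeta> \<le> cmod \<xi>"
    "cosh (hyp_radius E 0) = (1 + (cmod \<xi>)\<^sup>2) / (1 - (cmod \<xi>)\<^sup>2)"
    by (rule hyp_radius_0[OF E]) blast
  define s where "s = (cmod \<xi>)\<^sup>2"
  have s: "0 \<le> s" "s < 1"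
    using one_minus_norm_square_pos[OF subsetD[OF E(3) \<xi>(1)]] by (simp_all add: s_def)
  define R where "R = hyp_radius E 0"
  have "0 \<in> convex hull {\<zeta>\<in>E. cmod \<zeta> = cmod \<xi>}"
    by (rule circumcenter_0_convex_hull[OF E circ \<xi>(1) refl \<xi>(2)])
  then have "\<exists>S u. finite S \<and> S \<subseteq> {\<zeta>\<in>E. cmod \<zeta> = cmod \<xi>} \<and> card S \<le> 3 \<and>
      (\<forall>x\<in>S. 0 \<le> u x) \<and> sum u S = 1 \<and> (\<Sum>v\<in>S. u v *\<^sub>R v) = 0"
    unfolding convex_hull_caratheodory by simp
  then obtain S u where S: "finite S" "S \<subseteq> {\<zeta>\<in>E. cmod \<zeta> = cmod \<xi>}" "card S \<le> 3"
    and u: "\<And>x. x \<in> S \<Longrightarrow> 0 \<le> u x" "sum u S = 1" "(\<Sum>v\<in>S. u v *\<^sub>R v) = 0"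
    by blast
  have "\<exists>j\<in>S. 1 / 3 \<le> u j"
  proof (rule ccontr)
    assume "\<not> ?thesis"
    moreover have "S \<noteq> {}" using u(2) by auto
    ultimately have "sum u S < of_nat (card S) * (1 / 3)"
      using S(1) by (intro sum_bounded_above_strict) (auto simp: card_gt_0_iff not_le)
    also have "\<dots> \<le> 1" using S(3) by simp
    finally show False using u(2) by simp
  qed
  then obtain j where j: "j \<in> S" "1 / 3 \<le> u j" by blast
  have ball: "x \<in> unit_disk" "(cmod x)\<^sup>2 = s" if "x \<in> S" for x
    using that S(2) E(3) by (auto simp: s_def)
  \<comment> \<open>All points of \<open>S\<close> have squared modulus \<open>s\<close>, so
    \<open>q\<close> is the common denominator of \<open>cosh_dist\<close> on pairs from
    \<open>S\<close>.\<close>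
  define q where "q = (1 - s)\<^sup>2"
  have pair: "(1 + s)\<^sup>2 - 4 * (x \<bullet> j) \<le> cosh D * q" if "x \<in> S" for x
  proof -
    have "cosh_dist x j \<le> cosh D"
      using hyp_dist_le_iff[OF ball(1)[OF that] ball(1)[OF j(1)] \<open>0 \<le> D\<close>] diam that j(1) S(2) by blast
    moreover have "cosh_dist x j = ((1 + s) * (1 + s) - 4 * (x \<bullet> j)) / ((1 - s) * (1 - s))"
      unfolding cosh_dist_inner[OF ball(1)[OF that] ball(1)[OF j(1)]] ball(2)[OF that] ball(2)[OF j(1)] ..
    ultimately show ?thesis
      using s by (simp add: q_def power2_eq_square pos_divide_le_eq)
  qed
  have jj: "(1 + s)\<^sup>2 - 4 * (j \<bullet> j) = q"
    using ball(2)[OF j(1)] by (simp add: q_def flip: power2_norm_eq_inner) (simp add: power2_eq_square algebra_simps)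
  \<comment> \<open>The weighted mean of the points is 0, so the inner product vanishes. The term
    \<open>x = j\<close> of the resulting sum has distance 0; each of the others is bounded through
    the diameter.\<close>
  have "(1 + s)\<^sup>2 = (\<Sum>x\<in>S. u x) * (1 + s)\<^sup>2 - 4 * ((\<Sum>x\<in>S. u x *\<^sub>R x) \<bullet> j)"
    by (simp add: u)
  also have "\<dots> = (\<Sum>x\<in>S. u x * ((1 + s)\<^sup>2 - 4 * (x \<bullet> j)))"
    by (simp add: sum_distrib_right sum_distrib_left inner_sum_left sum_subtractf algebra_simps)
  also have "\<dots> = u j * q + (\<Sum>x\<in>S - {j}. u x * ((1 + s)\<^sup>2 - 4 * (x \<bullet> j)))"
    by (simp add: sum.remove[OF S(1) j(1)] jj)
  also have "\<dots> \<le> u j * q + (\<Sum>x\<in>S - {j}. u x * (cosh D * q))"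
    using pair u(1) by (intro add_left_mono sum_mono mult_left_mono) auto
  also have "\<dots> = u j * q + (1 - u j) * (cosh D * q)"
    using u(2) by (simp add: sum.remove[OF S(1) j(1)] flip: sum_distrib_right)
  finally have main: "(1 + s)\<^sup>2 \<le> q * (u j + (1 - u j) * cosh D)"
    by (simp add: algebra_simps)
  have q: "q > 0" using s by (simp add: q_def)
  have "(cosh R)\<^sup>2 = (1 + s)\<^sup>2 / q"
    using \<xi>(3) by (simp add: R_def s_def q_def power_divide)
  also have "\<dots> \<le> u j + (1 - u j) * cosh D"
    using main q by (simp add: divide_le_eq mult.commute)
  also have "\<dots> = cosh D - u j * (cosh D - 1)" by (simp add: algebra_simps)
  also have "\<dots> \<le> cosh D - 1 / 3 * (cosh D - 1)"
    using j(2) cosh_real_ge_1[of D] by (intro diff_left_mono mult_right_mono) auto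
  \<comment> \<open>The weight bound 1/3 leaves the factor 2/3; the half-angle formula then gives
    4/3 times the square of \<open>sinh (D / 2)\<close>, the square of the argument of
    \<open>arsinh\<close> in \<open>J_const\<close>.\<close>
  finally have "(sinh R)\<^sup>2 \<le> 2 / 3 * (cosh D - 1)"
    unfolding cosh_square_eq by (simp add: field_simps)
  moreover have "cosh D = 1 + 2 * (sinh (D / 2))\<^sup>2"
    using cosh_double_cosh[of "D / 2"] by (simp add: cosh_square_eq)
  ultimately have "(sinh R)\<^sup>2 \<le> (2 / sqrt 3 * sinh (D / 2))\<^sup>2"
    by (simp add: power_mult_distrib power_divide)
  then have "sinh R \<le> 2 / sqrt 3 * sinh (D / 2)"
    by (rule power2_le_imp_le) (use \<open>0 \<le> D\<close> in simp)
  then have "R \<le> arsinh (2 / sqrt 3 * sinh (D / 2))"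
    by (metis arsinh_less_iff_real arsinh_sinh_real not_le)
  then show ?thesis by (simp add: R_def J_const_def)
qed

section \<open>Moebius automorphisms as isometries and uniqueness of the circumcenter\<close>

text \<open>The effect on a dilatation of post-composing the mapping with
  \<open>\<lambda>w. a * w + b * cnj w + c\<close>; the coefficients are those of the affine
  mapping, without normalization.\<close>

definition mobius :: "complex \<Rightarrow> complex \<Rightarrow> complex \<Rightarrow> complex" where
  "mobius a b z = (cnj a * z + cnj b) / (a + b * z)"

lemma mobius_denominator_nonzero:
  assumes "cmod b < cmod a" "z \<in> unit_disk"
  shows "a + b * z \<noteq> 0"
proof
  assume "a + b * z = 0"
  then have "cmod a = cmod (b * z)" by (metis add_eq_0_iff2 norm_minus_cancel)
  also have "\<dots> \<le> cmod b * 1"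
    unfolding norm_mult using assms(2) by (intro mult_left_mono) auto
  finally show False using assms(1) by simp
qed

lemma mobius_in_disk:
  assumes "cmod b < cmod a" "z \<in> unit_disk"
  shows "mobius a b z \<in> unit_disk"
proof -
  have "(cmod (a + b * z))\<^sup>2 - (cmod (cnj a * z + cnj b))\<^sup>2 = ((cmod a)\<^sup>2 - (cmod b)\<^sup>2) * (1 - (cmod z)\<^sup>2)"
    unfolding cmod_power2 by (simp add: algebra_simps power2_eq_square)
  also have "\<dots> > 0"
    using assms(1) one_minus_norm_square_pos[OF assms(2)] by (simp add: power_strict_mono)
  finally have "cmod (cnj a * z + cnj b) < cmod (a + b * z)"
    by (simp add: power2_less_imp_less)
  then show ?thesis
    by (auto simp: mobius_def norm_divide divide_less_eq)
qed

text \<open>Numerator and denominator of the pseudo-hyperbolic quotient acquire factors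
  \<open>d / (p * q)\<close> and \<open>d / (p * cnj q)\<close> of equal modulus.\<close>

lemma hyp_dist_mobius:
  assumes "cmod b < cmod a" "z \<in> unit_disk" "w \<in> unit_disk"
  shows "hyp_dist (mobius a b z) (mobius a b w) = hyp_dist z w"
proof -
  define p where "p = a + b * z"
  define q where "q = a + b * w"
  have nz: "p \<noteq> 0" "q \<noteq> 0"
    using mobius_denominator_nonzero[OF assms(1)] assms(2,3) by (auto simp: p_def q_def)
  define d where "d = a * cnj a - b * cnj b"
  have "d = of_real ((cmod a)\<^sup>2 - (cmod b)\<^sup>2)"
    by (simp only: d_def of_real_diff complex_norm_square)
  moreover have "(cmod b)\<^sup>2 < (cmod a)\<^sup>2"
    using assms(1) by (intro power_strict_mono) auto
  ultimately have d: "d \<noteq> 0"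
    by (metis of_real_eq_0_iff right_minus_eq less_irrefl)
  have 1: "mobius a b z - mobius a b w = d * (z - w) / (p * q)"
    using nz unfolding mobius_def p_def[symmetric] q_def[symmetric]
    by (simp add: diff_frac_eq) (simp add: p_def q_def d_def algebra_simps)
  have 2: "1 - cnj (mobius a b w) * mobius a b z = d * (1 - cnj w * z) / (p * cnj q)"
  proof -
    have "1 - cnj (mobius a b w) * mobius a b z
        = (p * cnj q - (a * cnj w + b) * (cnj a * z + cnj b)) / (p * cnj q)"
      using nz by (simp add: mobius_def diff_divide_distrib mult.commute flip: p_def q_def)
    also have "p * cnj q - (a * cnj w + b) * (cnj a * z + cnj b) = d * (1 - cnj w * z)"
      by (simp add: p_def q_def d_def algebra_simps)
    finally show ?thesis .
  qed
  have "cmod ((mobius a b z - mobius a b w) / (1 - cnj (mobius a b w) * mobius a b z))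
      = cmod ((z - w) / (1 - cnj w * z))"
    unfolding 1 2 norm_divide norm_mult complex_mod_cnj using nz d by simp
  then show ?thesis unfolding hyp_dist_def by simp
qed

text \<open>The coefficients \<open>cnj a\<close> and \<open>- b\<close> come from the adjugate of
  the coefficient matrix.\<close>

lemma mobius_inverse:
  assumes "cmod b < cmod a" "w \<in> unit_disk"
  shows "mobius a b (mobius (cnj a) (- b) w) = w"
proof -
  have nz: "cnj a - b * w \<noteq> 0"
    using mobius_denominator_nonzero[of "- b" "cnj a" w] assms by simp
  define d where "d = a * cnj a - b * cnj b"
  have "mobius (cnj a) (- b) w \<in> unit_disk"
    using mobius_in_disk[of "- b" "cnj a" w] assms by simp
  from mobius_denominator_nonzero[OF assms(1) this]
  have nz': "a + b * ((a * w - cnj b) / (cnj a - b * w)) \<noteq> 0" by (simp add: mobius_def)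
  have "a + b * ((a * w - cnj b) / (cnj a - b * w)) = d / (cnj a - b * w)"
    using nz by (simp add: field_simps d_def)
  moreover have "cnj a * ((a * w - cnj b) / (cnj a - b * w)) + cnj b = d * w / (cnj a - b * w)"
    using nz by (simp add: field_simps d_def)
  ultimately show ?thesis using nz nz' by (simp add: mobius_def)
qed

lemma continuous_on_mobius:
  assumes "cmod b < cmod a" "S \<subseteq> unit_disk"
  shows "continuous_on S (mobius a b)"
  unfolding mobius_def using mobius_denominator_nonzero[OF assms(1)] assms(2)
  by (intro continuous_intros) blast

lemma hyp_radius_mobius:
  assumes "cmod b < cmod a" "E \<subseteq> unit_disk" "c \<in> unit_disk"
  shows "hyp_radius (mobius a b ` E) (mobius a b c) = hyp_radius E c"
  unfolding hyp_radius_def image_image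
  using assms by (intro arg_cong[where f = Sup] image_cong refl hyp_dist_mobius) auto

text \<open>Every competing center \<open>w\<close> is the image of a disk point \<open>v\<close>,
  and the isometry preserves both radii.\<close>

lemma is_circumcenter_mobius:
  assumes "cmod b < cmod a" "E \<subseteq> unit_disk" "is_circumcenter E c"
  shows "is_circumcenter (mobius a b ` E) (mobius a b c)"
  unfolding is_circumcenter_def
proof (intro conjI ballI)
  have c: "c \<in> unit_disk" using assms(3) by (simp add: is_circumcenter_def)
  then show "mobius a b c \<in> unit_disk" by (rule mobius_in_disk[OF assms(1)])
  fix w assume w: "w \<in> unit_disk"
  define v where "v = mobius (cnj a) (- b) w"
  have v: "v \<in> unit_disk" unfolding v_def by (rule mobius_in_disk) (use assms(1) w in auto)
  have vw: "mobius a b v = w" unfolding v_def by (rule mobius_inverse[OF assms(1) w])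
  have "hyp_radius E c \<le> hyp_radius E v" using assms(3) v by (simp add: is_circumcenter_def)
  then show "hyp_radius (mobius a b ` E) (mobius a b c) \<le> hyp_radius (mobius a b ` E) w"
    using hyp_radius_mobius[OF assms(1,2) c] hyp_radius_mobius[OF assms(1,2) v] vw by simp
qed

lemma mobius_image:
  assumes "cmod b < cmod a" "compact E" "E \<noteq> {}" "E \<subseteq> unit_disk"
  shows "compact (mobius a b ` E)" "mobius a b ` E \<noteq> {}" "mobius a b ` E \<subseteq> unit_disk"
  using assms mobius_in_disk[OF assms(1)]
  by (auto intro!: compact_continuous_image continuous_on_mobius)

lemma mobius_centering: "mobius 1 (- cnj c) c = 0"
  by (simp add: mobius_def)

text \<open>An automorphism carrying \<open>c\<close> to 0 reduces this to
  \<open>circumcenter_0_unique\<close>; only \<open>c\<close> itself is carried to 0.\<close>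

lemma circumcenter_unique:
  assumes E: "compact E" "E \<noteq> {}" "E \<subseteq> unit_disk"
    and c: "is_circumcenter E c" and c': "is_circumcenter E c'"
  shows "c' = c"
proof -
  have disk: "c \<in> unit_disk" "c' \<in> unit_disk"
    using c c' by (auto simp: is_circumcenter_def)
  then have lt: "cmod (- cnj c) < cmod 1" by simp
  have "mobius 1 (- cnj c) c' = 0"
    using circumcenter_0_unique[OF mobius_image[OF lt E]]
      is_circumcenter_mobius[OF lt E(3) c] is_circumcenter_mobius[OF lt E(3) c']
    by (simp only: mobius_centering)
  then show ?thesis
    using mobius_denominator_nonzero[OF lt disk(2)] by (simp add: mobius_def)
qed

lemma circumcenter_eqI:
  assumes E: "compact E" "E \<noteq> {}" "E \<subseteq> unit_disk" and c: "is_circumcenter E c"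
  shows "circumcenter E = c"
  unfolding circumcenter_def hyp_radius_def[symmetric] is_circumcenter_iff_Inf[OF E, symmetric]
  using c circumcenter_unique[OF E c] by (rule the_equality)

lemma is_circumcenter_circumcenter:
  assumes E: "compact E" "E \<noteq> {}" "E \<subseteq> unit_disk"
  shows "is_circumcenter E (circumcenter E)"
  using ex_circumcenter[OF E] circumcenter_eqI[OF E] by auto

section \<open>From the hyperbolic diameter to the bound on moduli\<close>

text \<open>A real supremum dominates its elements only when they are bounded; here the bound is the
  maximum over the compact product.\<close>

lemma hyp_dist_le_diameter:
  assumes E: "compact E" "E \<subseteq> unit_disk" and zw: "z \<in> E" "w \<in> E"
  shows "hyp_dist z w \<le> hyp_diameter E"
proof -
  have "continuous_on (E \<times> E) (\<lambda>p. cosh_dist (fst p) (snd p))"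
    using E(2) by (intro continuous_intros) auto
  moreover have "compact (E \<times> E)" "E \<times> E \<noteq> {}" using E(1) zw by (auto intro: compact_Times)
  ultimately have "\<exists>p\<in>E \<times> E. \<forall>q\<in>E \<times> E. cosh_dist (fst q) (snd q) \<le> cosh_dist (fst p) (snd p)"
    by (intro continuous_attains_sup)
  then obtain p where p: "p \<in> E \<times> E"
    "\<And>q. q \<in> E \<times> E \<Longrightarrow> cosh_dist (fst q) (snd q) \<le> cosh_dist (fst p) (snd p)"
    by blast
  have pd: "fst p \<in> unit_disk" "snd p \<in> unit_disk" using p(1) E(2) by auto
  have "hyp_dist (fst q) (snd q) \<le> hyp_dist (fst p) (snd p)" if q: "q \<in> E \<times> E" for q
  proof -
    have "fst q \<in> unit_disk" "snd q \<in> unit_disk" using q E(2) by auto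
    then show ?thesis
      using hyp_dist_le_iff[OF _ _ cosh_hyp_dist(2)[OF pd]] cosh_hyp_dist(1)[OF pd] p(2)[OF q] by simp
  qed
  then have "bdd_above ((\<lambda>(z, w). hyp_dist z w) ` (E \<times> E))"
    by (intro bdd_aboveI[of _ "hyp_dist (fst p) (snd p)"]) auto
  from cSUP_upper[OF _ this, of "(z, w)"] show ?thesis
    using zw by (simp add: hyp_diameter_def)
qed

lemma J_const_nonneg:
  assumes "0 \<le> D"
  shows "0 \<le> J_const D"
proof -
  have "\<not> 2 / sqrt 3 * sinh (D / 2) < 0" using assms by (simp add: not_less)
  then show ?thesis unfolding J_const_def using arsinh_real_neg_iff not_less by blast
qed

lemma k_const_less_1: "k_const D < 1"
  by (simp add: k_const_def tanh_real_lt_1)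

text \<open>The number \<open>k_const D\<close> is the modulus of a point at distance
  \<open>J_const D\<close> from 0, because \<open>hyp_dist 0\<close> is twice \<open>artanh\<close>
  of the modulus.\<close>

lemma Jung_at_circumcenter_0:
  assumes E: "compact E" "E \<noteq> {}" "E \<subseteq> unit_disk" and circ: "is_circumcenter E 0"
    and D: "0 \<le> D" "\<And>z w. z \<in> E \<Longrightarrow> w \<in> E \<Longrightarrow> hyp_dist z w \<le> D" and \<zeta>: "\<zeta> \<in> E"
  shows "cmod \<zeta> \<le> k_const D"
proof -
  have z0: "(0::complex) \<in> unit_disk" by simp
  define k where "k = k_const D"
  have J0: "0 \<le> J_const D" by (rule J_const_nonneg[OF D(1)])
  then have k: "0 \<le> k" "k < 1"
    using k_const_less_1 by (auto simp: k_def k_const_def)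
  then have kd: "of_real k \<in> unit_disk" by simp
  have \<zeta>d: "\<zeta> \<in> unit_disk" using \<zeta> E(3) by blast
  have "hyp_dist 0 (of_real k) = J_const D"
    using k by (simp add: hyp_dist_def) (simp add: k_def k_const_def artanh_tanh_real)
  moreover have "hyp_dist 0 \<zeta> \<le> J_const D"
    using circumcenter_0_Jung[OF E circ D] hyp_radius_le_iff[OF E z0] \<zeta> by blast
  ultimately have "cosh_dist 0 \<zeta> \<le> cosh_dist 0 (of_real k)"
    using hyp_dist_le_iff[OF z0 \<zeta>d J0] cosh_hyp_dist(1)[OF z0 kd] by simp
  then have "(cmod \<zeta>)\<^sup>2 \<le> k\<^sup>2"
    using one_minus_norm_square_pos[OF \<zeta>d] one_minus_norm_square_pos[OF kd]
    unfolding cosh_dist_0[OF \<zeta>d] cosh_dist_0[OF kd] by (simp add: one_plus_div_one_minus_le_iff)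
  then show ?thesis using k(1) unfolding k_def[symmetric] by (rule power2_le_imp_le)
qed

subsection \<open>Compactness of univalent harmonic mappings with bounded dilatation\<close>

text \<open>The difference quotient at 0 is entire and free of zeros. Its reciprocal grows at most
  linearly, hence is a polynomial of degree at most 1, and having no zeros it is constant.\<close>

lemma injective_entire_affine:
  assumes h: "h holomorphic_on UNIV" and inj: "inj h"
  shows "h z = h 0 + deriv h 0 * z"
proof -
  define q where "q = (\<lambda>z. if z = 0 then deriv h 0 else (h z - h 0) / (z - 0))"
  have q: "q holomorphic_on UNIV"
    unfolding q_def by (rule pole_lemma_open[OF h open_UNIV])
  have d0: "deriv h 0 \<noteq> 0"
    using holomorphic_injective_imp_regular[OF h open_UNIV inj] by simp
  have q0: "q z \<noteq> 0" for z
    using d0 inj by (auto simp: q_def inj_def)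
  define p where "p = (\<lambda>z. inverse (q z))"
  have p: "p holomorphic_on UNIV"
    unfolding p_def using q q0 by (intro holomorphic_intros) auto
  have "open (h ` ball 0 1)"
    by (rule open_mapping_thm3) (use h inj in \<open>auto intro: holomorphic_on_subset inj_on_subset\<close>)
  then obtain r where r: "r > 0" "ball (h 0) r \<subseteq> h ` ball 0 1"
    by (meson open_contains_ball centre_in_ball imageI zero_less_one)
  \<comment> \<open>By injectivity, the values near \<open>h 0\<close> are already used up inside
    the unit disk.\<close>
  have far: "r \<le> cmod (h z - h 0)" if "1 \<le> cmod z" for z
  proof (rule ccontr)
    assume "\<not> ?thesis"
    then have "h z \<in> ball (h 0) r"
      by (simp add: dist_norm norm_minus_commute)
    with r(2) obtain z' where "z' \<in> ball 0 1" "h z = h z'" by blast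
    with injD[OF inj this(2)] that show False by simp
  qed
  have pb: "cmod (p z) \<le> (1 / r) * cmod z ^ 1" if "1 \<le> cmod z" for z
  proof -
    have "p z = z / (h z - h 0)" using that by (auto simp: p_def q_def)
    then have "cmod (p z) = cmod z / cmod (h z - h 0)" by (simp add: norm_divide)
    also have "\<dots> \<le> cmod z / r"
      using far[OF that] r(1) by (intro frac_le) auto
    finally show ?thesis by simp
  qed
  have plin: "p z = p 0 + deriv p 0 * z" for z
    using Liouville_polynomial[OF p pb, of 1 z] by (simp add: atMost_Suc)
  have "deriv p 0 = 0"
  proof (rule ccontr)
    assume "deriv p 0 \<noteq> 0"
    then have "p (- p 0 / deriv p 0) = 0"
      by (subst plin) simp
    then show False using q0 by (simp add: p_def)
  qed
  then have "p z = p 0" using plin[of z] by simp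
  then have "q z = q 0" by (simp add: p_def)
  then show ?thesis by (cases "z = 0") (auto simp: q_def field_simps)
qed

text \<open>A holomorphic logarithm of \<open>u\<close> has derivative bounded by \<open>B\<close>,
  so it is Lipschitz. The use is with \<open>u\<close> the derivative of an analytic part.\<close>

lemma logarithmic_derivative_growth:
  assumes "convex S" "open S" and u: "u holomorphic_on S"
    and nz: "\<And>z. z \<in> S \<Longrightarrow> u z \<noteq> 0"
    and B: "\<And>z. z \<in> S \<Longrightarrow> cmod (deriv u z) \<le> B * cmod (u z)"
    and "x \<in> S" "y \<in> S"
  shows "cmod (u y) \<le> cmod (u x) * exp (B * cmod (y - x))"
proof -
  obtain l where l: "l holomorphic_on S" "\<And>z. z \<in> S \<Longrightarrow> exp (l z) = u z"
    using holomorphic_logarithm_exists[OF \<open>convex S\<close> \<open>open S\<close> u nz \<open>x \<in> S\<close>] by metis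
  have dl: "(l has_field_derivative deriv l z) (at z)" if "z \<in> S" for z
    using holomorphic_derivI[OF l(1) \<open>open S\<close> that] by simp
  have "deriv u z = u z * deriv l z" if "z \<in> S" for z
  proof -
    have "((\<lambda>z. exp (l z)) has_field_derivative exp (l z) * deriv l z) (at z)"
      using dl[OF that] by (auto intro!: derivative_eq_intros)
    then have "(u has_field_derivative exp (l z) * deriv l z) (at z)"
      by (rule has_field_derivative_transform_within_open[OF _ \<open>open S\<close> that l(2)])
    then show ?thesis using l(2)[OF that] by (simp add: DERIV_imp_deriv)
  qed
  then have "cmod (deriv l z) \<le> B" if "z \<in> S" for z
    using B[OF that] nz[OF that] that by (simp add: norm_mult mult.commute)
  then have "cmod (l y - l x) \<le> B * cmod (y - x)"
    using field_differentiable_bound[OF \<open>convex S\<close>, of l "deriv l" B y x] dl assms(6,7)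
    by (auto intro: has_field_derivative_at_within)
  then have "Re (l y - l x) \<le> B * cmod (y - x)"
    using complex_Re_le_cmod order_trans by blast
  then have "exp (Re (l y)) \<le> exp (Re (l x)) * exp (B * cmod (y - x))"
    by (simp flip: exp_add)
  then show ?thesis
    using l(2)[OF \<open>x \<in> S\<close>] l(2)[OF \<open>y \<in> S\<close>] by (metis norm_exp_eq_Re)
qed

section \<open>Stability of values and of injectivity under uniform limits\<close>

text \<open>Solutions of \<open>F n z = L z0\<close> are the fixed points of the Newton-type map
  \<open>\<Phi>\<close>, which sends a small closed ball into itself; Brouwer's theorem
  applies.\<close>

lemma uniform_limit_attains_value:
  fixes L :: "'a::euclidean_space \<Rightarrow> 'a"
  assumes L: "(L has_derivative T) (at z0)" and T': "bounded_linear T'"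
    and T'T: "\<And>x. T' (T x) = x" and TT': "\<And>x. T (T' x) = x"
    and "0 < r" and lim: "uniform_limit (cball z0 r) F L sequentially"
    and cont: "\<forall>\<^sub>F n in sequentially. continuous_on (cball z0 r) (F n)"
  shows "\<forall>\<^sub>F n in sequentially. \<exists>z\<in>cball z0 r. F n z = L z0"
proof -
  interpret T': bounded_linear T' by fact
  obtain B where B: "B > 0" "\<And>x. norm (T' x) \<le> norm x * B"
    using T'.pos_bounded by blast
  \<comment> \<open>With \<open>1 / (2 * B)\<close>, the linearization error contributes at most
    \<open>s / 2\<close> after applying \<open>T'\<close>; the uniform error is given the other
    half.\<close>
  from L[unfolded has_derivative_at_alt] obtain d where d: "d > 0"
    "\<And>y. norm (y - z0) < d \<Longrightarrow> norm (L y - L z0 - T (y - z0)) \<le> 1 / (2 * B) * norm (y - z0)"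
    using B(1) by (metis zero_less_divide_1_iff zero_less_mult_iff zero_less_numeral)
  define s where "s = min r (d / 2)"
  have s: "0 < s" "s \<le> r" "s < d"
    using d(1) \<open>0 < r\<close> by (auto simp: s_def)
  have "\<forall>\<^sub>F n in sequentially. \<forall>z\<in>cball z0 r. dist (F n z) (L z) < s / (2 * B)"
    using uniform_limitD[OF lim] s(1) B(1) by simp
  then show ?thesis using cont
  proof eventually_elim
    case (elim n)
    define \<Phi> where "\<Phi> = (\<lambda>z. z - T' (F n z - L z0))"
    have "continuous_on (cball z0 s) \<Phi>"
      unfolding \<Phi>_def using elim(2) s(2)
      by (intro continuous_intros T'.continuous_on) (meson continuous_on_subset subset_cball)
    moreover have "\<Phi> z \<in> cball z0 s" if "z \<in> cball z0 s" for z
    proof -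
      have z: "norm (z - z0) \<le> s" "z \<in> cball z0 r"
        using that s(2) by (auto simp: dist_norm norm_minus_commute)
      have "\<Phi> z - z0 = - T' ((L z - L z0 - T (z - z0)) + (F n z - L z))"
        by (simp add: \<Phi>_def T'.diff T'.add T'.neg T'T)
      then have "norm (\<Phi> z - z0) \<le> norm ((L z - L z0 - T (z - z0)) + (F n z - L z)) * B"
        using B(2) by (metis norm_minus_cancel)
      also have "\<dots> \<le> (1 / (2 * B) * s + s / (2 * B)) * B"
      proof (intro mult_right_mono norm_triangle_le add_mono)
        show "norm (L z - L z0 - T (z - z0)) \<le> 1 / (2 * B) * s"
          using d(2)[of z] z(1) s(3) B(1)
          by (smt (verit) mult_left_mono zero_less_divide_1_iff)
        show "norm (F n z - L z) \<le> s / (2 * B)"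
          using elim(1) z(2) by (metis dist_norm less_imp_le)
      qed (use B in auto)
      also have "\<dots> = s" using B(1) by (simp add: field_simps)
      finally show ?thesis by (simp add: dist_norm norm_minus_commute)
    qed
    ultimately obtain z where z: "z \<in> cball z0 s" "\<Phi> z = z"
      using brouwer[of "cball z0 s" \<Phi>] s(1) by auto
    then have "T' (F n z - L z0) = 0" by (simp add: \<Phi>_def)
    then have "F n z = L z0"
      using TT' T'.zero T'T by (metis eq_iff_diff_eq_0)
    then show ?case using z(1) s(2) by auto
  qed
qed

text \<open>If \<open>L\<close> took one value at two points, the approximants would attain it near
  each of them, on disjoint balls. Injectivity is asked only on compact sets and only eventually, so
  the domains of the approximants may grow with the index.\<close>

lemma injective_uniform_limit:
  fixes L :: "'a::euclidean_space \<Rightarrow> 'a"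
  assumes "open S"
    and inv: "\<And>z. z \<in> S \<Longrightarrow> \<exists>T T'. (L has_derivative T) (at z) \<and> bounded_linear T' \<and>
               (\<forall>x. T' (T x) = x) \<and> (\<forall>x. T (T' x) = x)"
    and lim: "\<And>K. compact K \<Longrightarrow> K \<subseteq> S \<Longrightarrow> uniform_limit K F L sequentially"
    and inj: "\<And>K. compact K \<Longrightarrow> K \<subseteq> S \<Longrightarrow>
               \<forall>\<^sub>F n in sequentially. continuous_on K (F n) \<and> inj_on (F n) K"
  shows "inj_on L S"
proof (rule inj_onI, rule ccontr)
  fix x y assume xy: "x \<in> S" "y \<in> S" "L x = L y" "x \<noteq> y"
  obtain a b where ab: "a > 0" "cball x a \<subseteq> S" "b > 0" "cball y b \<subseteq> S"
    using \<open>open S\<close> xy(1,2) by (meson open_contains_cball)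
  define r where "r = min (min a b) (dist x y / 3)"
  have r: "r > 0" "r \<le> a" "r \<le> b" "3 * r \<le> dist x y"
    using ab xy(4) by (auto simp: r_def)
  have sub: "cball x r \<subseteq> S" "cball y r \<subseteq> S"
    using ab r by (meson order_trans subset_cball)+
  have hit: "\<forall>\<^sub>F n in sequentially. \<exists>z\<in>cball w r. F n z = L w"
    if w: "w \<in> S" "cball w r \<subseteq> S" for w
  proof -
    from inv[OF w(1)] obtain T T' where T: "(L has_derivative T) (at w)" "bounded_linear T'"
      "\<And>x. T' (T x) = x" "\<And>x. T (T' x) = x" by blast
    show ?thesis
      by (rule uniform_limit_attains_value[OF T r(1) lim[OF compact_cball w(2)]])
        (use inj[OF compact_cball w(2)] in \<open>auto elim: eventually_mono\<close>)
  qed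
  have "compact (cball x r \<union> cball y r)" by (intro compact_Un compact_cball)
  from inj[OF this] sub have "\<forall>\<^sub>F n in sequentially. inj_on (F n) (cball x r \<union> cball y r)"
    by (auto elim: eventually_mono)
  with hit[OF xy(1) sub(1)] hit[OF xy(2) sub(2)] have "\<forall>\<^sub>F n in sequentially. False"
  proof eventually_elim
    case (elim n)
    then obtain z w where zw: "z \<in> cball x r" "w \<in> cball y r" "F n z = L x" "F n w = L y" by blast
    with elim(3) xy(3) have "z = w" by (auto simp: inj_on_def)
    with zw(1,2) have "dist x y \<le> 2 * r"
      using dist_triangle2[of x y z] by (simp add: dist_commute)
    with r show ?case by simp
  qed
  then show False by simp
qed

section \<open>Normal families on growing balls\<close>

text \<open>On each fixed ball Montel's theorem applies once finitely many terms are dropped; a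
  diagonal subsequence handles all integer radii at once.\<close>

lemma Montel_growing_balls:
  fixes h :: "nat \<Rightarrow> complex \<Rightarrow> complex" and M :: "nat \<Rightarrow> real"
  assumes hol: "\<And>n. h n holomorphic_on ball 0 (M n)" and M: "filterlim M at_top sequentially"
    and bd: "\<And>R. \<exists>B. \<forall>n z. cmod z \<le> R \<and> cmod z < M n \<longrightarrow> cmod (h n z) \<le> B"
  obtains r H where "strict_mono (r :: nat \<Rightarrow> nat)" "H holomorphic_on UNIV"
    "\<And>K. compact K \<Longrightarrow> uniform_limit K (\<lambda>n. h (r n)) H sequentially"
proof -
  define P where "P = (\<lambda>j s. \<exists>l. l holomorphic_on ball 0 (real j) \<and>
    (\<forall>K. compact K \<and> K \<subseteq> ball 0 (real j) \<longrightarrow> uniform_limit K (\<lambda>n. h (s n)) l sequentially))"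
  have large: "\<exists>N. \<forall>n\<ge>N. real j \<le> M (s n)" if "strict_mono s" for j and s :: "nat \<Rightarrow> nat"
    using filterlim_compose[OF M filterlim_subseq[OF that]]
    by (simp add: filterlim_at_top eventually_sequentially)
  have ex: "\<exists>r'. strict_mono r' \<and> P j (s \<circ> r')" if s: "strict_mono s" for j and s :: "nat \<Rightarrow> nat"
  proof -
    \<comment> \<open>Earlier terms may have a domain smaller than the ball, so the sequence is
      shifted by \<open>N\<close>.\<close>
    obtain N where N: "\<And>n. n \<ge> N \<Longrightarrow> real j \<le> M (s n)" using large[OF s] by blast
    define \<F> where "\<F> = (\<lambda>n. h (s (n + N)))"
    have 1: "\<F> n holomorphic_on ball 0 (real j)" for n
      unfolding \<F>_def by (rule holomorphic_on_subset[OF hol]) (use N[of "n + N"] in auto)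
    have 2: "\<exists>B. \<forall>f\<in>range \<F>. \<forall>z\<in>K. cmod (f z) \<le> B" if K: "K \<subseteq> ball 0 (real j)" for K
    proof -
      obtain B where B: "\<And>n z. cmod z \<le> real j \<and> cmod z < M n \<Longrightarrow> cmod (h n z) \<le> B"
        using bd[of "real j"] by blast
      have "cmod (\<F> n z) \<le> B" if "z \<in> K" for n z
        unfolding \<F>_def by (rule B) (use K that N[of "n + N"] in fastforce)
      then show ?thesis by blast
    qed
    obtain g r where gr: "g holomorphic_on ball 0 (real j)" "strict_mono (r :: nat \<Rightarrow> nat)"
      "\<And>K. \<lbrakk>compact K; K \<subseteq> ball 0 (real j)\<rbrakk> \<Longrightarrow> uniform_limit K (\<F> \<circ> r) g sequentially"
    proof (rule Montel[OF open_ball[of 0 "real j"], of "range \<F>" \<F>])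
      show "f holomorphic_on ball 0 (real j)" if "f \<in> range \<F>" for f using that 1 by blast
      show "\<exists>B. \<forall>f\<in>range \<F>. \<forall>z\<in>K. cmod (f z) \<le> B"
        if "compact K" "K \<subseteq> ball 0 (real j)" for K using 2[OF that(2)] .
    qed (simp, use that in blast)
    have "strict_mono (\<lambda>n. r n + N)" using gr(2) by (auto simp: strict_mono_def)
    moreover have "P j (s \<circ> (\<lambda>n. r n + N))"
      unfolding P_def using gr(1,3) by (auto simp: \<F>_def o_def)
    ultimately show ?thesis by blast
  qed
  interpret subseqs P by unfold_locales (rule ex)
  have sub: "P j (s \<circ> r)" if "strict_mono r" "P j s" for j r s
  proof -
    from that(2) obtain l where l: "l holomorphic_on ball 0 (real j)"
      "\<And>K. compact K \<Longrightarrow> K \<subseteq> ball 0 (real j) \<Longrightarrow> uniform_limit K (\<lambda>n. h (s n)) l sequentially"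
      unfolding P_def by blast
    have "uniform_limit K (\<lambda>n. h (s (r n))) l sequentially"
      if "compact K" "K \<subseteq> ball 0 (real j)" for K
      using filterlim_compose[OF l(2)[OF that] filterlim_subseq[OF \<open>strict_mono r\<close>]] .
    with l(1) show ?thesis unfolding P_def o_def by blast
  qed
  \<comment> \<open>Stage \<open>j\<close> controls the diagonal sequence from index
    \<open>Suc j\<close> on; the missing initial segment does not affect limits.\<close>
  have diag: "P j (\<lambda>n. diagseq (n + Suc j))" for j
    using diagseq_holds[of j, OF sub] by (simp add: o_def add.commute)
  have "\<exists>l. l holomorphic_on ball 0 (real j) \<and>
    (\<forall>K. compact K \<and> K \<subseteq> ball 0 (real j) \<longrightarrow> uniform_limit K (\<lambda>n. h (diagseq n)) l sequentially)" for j
  proof -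
    from diag[of j]
    obtain l where l: "l holomorphic_on ball 0 (real j)"
      "\<And>K. compact K \<Longrightarrow> K \<subseteq> ball 0 (real j) \<Longrightarrow>
        uniform_limit K (\<lambda>n. h (diagseq (n + Suc j))) l sequentially"
      unfolding P_def by blast
    have "uniform_limit K (\<lambda>n. h (diagseq n)) l sequentially"
      if "compact K" "K \<subseteq> ball 0 (real j)" for K
    proof (rule uniform_limitI)
      fix e :: real assume "e > 0"
      from uniform_limitD[OF l(2)[OF that] this]
      show "\<forall>\<^sub>F n in sequentially. \<forall>x\<in>K. dist (h (diagseq n) x) (l x) < e"
        by (rule eventually_sequentially_seg[THEN iffD1])
    qed
    with l(1) show ?thesis by blast
  qed
  then obtain l where l: "\<And>j. l j holomorphic_on ball 0 (real j)"
    "\<And>j K. \<lbrakk>compact K; K \<subseteq> ball 0 (real j)\<rbrakk> \<Longrightarrow> uniform_limit K (\<lambda>n. h (diagseq n)) (l j) sequentially"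
    by metis
  \<comment> \<open>The pointwise limit glues the functions \<open>l j\<close>, which agree with it
    on their balls.\<close>
  define H where "H = (\<lambda>z. lim (\<lambda>n. h (diagseq n) z))"
  have Heq: "H z = l j z" if "z \<in> ball 0 (real j)" for z j
  proof -
    have "(\<lambda>n. h (diagseq n) z) \<longlonglongrightarrow> l j z"
      using l(2)[of "{z}" j] that by simp
    then show ?thesis by (simp add: H_def limI)
  qed
  have "H holomorphic_on ball 0 (real j)" for j
    using l(1)[of j] by (rule holomorphic_transform) (simp add: Heq)
  then have "H holomorphic_on (\<Union>j. ball 0 (real j))"
    by (intro holomorphic_on_UN_open) auto
  moreover have "(\<Union>j. ball 0 (real j)) = (UNIV :: complex set)"
    using reals_Archimedean2 by auto
  ultimately have "H holomorphic_on UNIV" by simp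
  moreover have "uniform_limit K (\<lambda>n. h (diagseq n)) H sequentially" if K: "compact K" for K
  proof -
    obtain B where B: "\<And>z. z \<in> K \<Longrightarrow> cmod z \<le> B"
      using compact_imp_bounded[OF K] by (auto simp: bounded_iff)
    obtain j where "B < real j" using reals_Archimedean2 by blast
    with B have Kj: "K \<subseteq> ball 0 (real j)" by force
    show ?thesis
      using l(2)[OF K Kj] by (rule uniform_limit_cong'[THEN iffD1, rotated 2]) (use Kj Heq in auto)
  qed
  ultimately show ?thesis using that subseq_diagseq by blast
qed

section \<open>Pairs of analytic parts with bounded dilatation\<close>

lemma harmonic_has_derivative:
  assumes "(h has_field_derivative a) (at z)" "(g has_field_derivative b) (at z)"
  shows "((\<lambda>z. h z + cnj (g z)) has_derivative (\<lambda>t. a * t + cnj (b * t))) (at z)"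
  using assms unfolding has_field_derivative_def
  by (intro has_derivative_add bounded_linear.has_derivative[OF bounded_linear_cnj])

text \<open>Cramer's rule: \<open>d\<close> is the real determinant, which is positive here.\<close>

lemma orientation_preserving_linear_inverse:
  fixes a b :: complex
  assumes "cmod b < cmod a"
  shows "\<exists>T'. bounded_linear T' \<and> (\<forall>x. T' (a * x + cnj (b * x)) = x) \<and>
              (\<forall>x. a * T' x + cnj (b * T' x) = x)"
proof -
  define d where "d = a * cnj a - b * cnj b"
  have deq: "d = of_real ((cmod a)\<^sup>2 - (cmod b)\<^sup>2)"
    by (simp only: d_def of_real_diff complex_norm_square)
  have "(cmod b)\<^sup>2 < (cmod a)\<^sup>2"
    using assms by (intro power_strict_mono) auto
  with assms have d: "d \<noteq> 0" "cnj d = d"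
    unfolding deq of_real_eq_0_iff complex_cnj_complex_of_real by simp_all
  define T' where "T' = (\<lambda>x. (cnj a * x - cnj b * cnj x) / d)"
  have "bounded_linear T'"
    unfolding T'_def by (intro bounded_linear_divide[THEN bounded_linear_compose] bounded_linear_sub
      bounded_linear_const_mult bounded_linear_mult_right bounded_linear_cnj)
  moreover have "T' (a * x + cnj (b * x)) = x" for x
    using d(1) by (simp add: T'_def field_simps) (simp add: d_def algebra_simps)
  moreover have "a * T' x + cnj (b * T' x) = x" for x
    using d by (simp add: T'_def field_simps) (simp add: d_def algebra_simps)
  ultimately show ?thesis by blast
qed

text \<open>The set is a parameter because disks, growing balls, compact sets and the whole plane
  all occur. The dilatation bound is multiplied out, so that it passes to limits directly.\<close>

definition qc_pair :: "real \<Rightarrow> complex set \<Rightarrow> (complex \<Rightarrow> complex) \<Rightarrow> (complex \<Rightarrow> complex) \<Rightarrow> bool" where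
  "qc_pair k S h g \<longleftrightarrow> h holomorphic_on S \<and> g holomorphic_on S \<and>
     inj_on (\<lambda>z. h z + cnj (g z)) S \<and>
     (\<forall>z\<in>S. deriv h z \<noteq> 0 \<and> cmod (deriv g z) \<le> k * cmod (deriv h z))"

lemma qc_pair_subset: "qc_pair k S h g \<Longrightarrow> T \<subseteq> S \<Longrightarrow> qc_pair k T h g"
  unfolding qc_pair_def by (meson holomorphic_on_subset inj_on_subset subsetD)

lemma higher_deriv_compact_limit:
  assumes "open S" "z \<in> S"
    and "\<And>K. compact K \<Longrightarrow> K \<subseteq> S \<Longrightarrow> uniform_limit K h H sequentially"
    and "\<And>K. compact K \<Longrightarrow> K \<subseteq> S \<Longrightarrow> \<forall>\<^sub>F n in sequentially. h n holomorphic_on K"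
  shows "(\<lambda>n. (deriv ^^ m) (h n) z) \<longlonglongrightarrow> (deriv ^^ m) H z"
proof -
  obtain e where e: "e > 0" "cball z e \<subseteq> S"
    using assms(1,2) by (meson open_contains_cball)
  show ?thesis
  proof (rule higher_deriv_complex_uniform_limit)
    show "uniform_limit (ball z e) h H sequentially"
      by (rule uniform_limit_on_subset[OF assms(3)[OF compact_cball e(2)] ball_subset_cball])
    show "\<forall>\<^sub>F n in sequentially. h n holomorphic_on ball z e"
      using assms(4)[OF compact_cball e(2)]
      by eventually_elim (rule holomorphic_on_subset[OF _ ball_subset_cball])
  qed (use e in auto)
qed

text \<open>Derivatives converge, which gives the dilatation bound; with \<open>k < 1\<close> and
  \<open>deriv H\<close> free of zeros, the real derivative of the limit is invertible and
  \<open>injective_uniform_limit\<close> applies. The applications obtain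
  \<open>deriv H z \<noteq> 0\<close> from the lower bound in \<open>qc_pair_growth\<close>.\<close>

lemma qc_pair_limit:
  assumes "k < 1" "open S"
    and H: "H holomorphic_on S" "\<And>z. z \<in> S \<Longrightarrow> deriv H z \<noteq> 0" and G: "G holomorphic_on S"
    and limh: "\<And>K. compact K \<Longrightarrow> K \<subseteq> S \<Longrightarrow> uniform_limit K h H sequentially"
    and limg: "\<And>K. compact K \<Longrightarrow> K \<subseteq> S \<Longrightarrow> uniform_limit K g G sequentially"
    and qc: "\<And>K. compact K \<Longrightarrow> K \<subseteq> S \<Longrightarrow> \<forall>\<^sub>F n in sequentially. qc_pair k K (h n) (g n)"
  shows "qc_pair k S H G"
proof -
  have holh: "\<forall>\<^sub>F n in sequentially. h n holomorphic_on K"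
    and holg: "\<forall>\<^sub>F n in sequentially. g n holomorphic_on K" if "compact K" "K \<subseteq> S" for K
    by (rule eventually_mono[OF qc[OF that]], simp add: qc_pair_def)+
  have bd: "cmod (deriv G z) \<le> k * cmod (deriv H z)" if z: "z \<in> S" for z
  proof (rule tendsto_le[OF sequentially_bot])
    have "(\<lambda>n. (deriv ^^ 1) (h n) z) \<longlonglongrightarrow> (deriv ^^ 1) H z"
      by (rule higher_deriv_compact_limit[OF \<open>open S\<close> z limh holh])
    then show "(\<lambda>n. k * cmod (deriv (h n) z)) \<longlonglongrightarrow> k * cmod (deriv H z)"
      by (intro tendsto_intros) simp
    have "(\<lambda>n. (deriv ^^ 1) (g n) z) \<longlonglongrightarrow> (deriv ^^ 1) G z"
      by (rule higher_deriv_compact_limit[OF \<open>open S\<close> z limg holg])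
    then show "(\<lambda>n. cmod (deriv (g n) z)) \<longlonglongrightarrow> cmod (deriv G z)"
      by (intro tendsto_intros) simp
    show "\<forall>\<^sub>F n in sequentially. cmod (deriv (g n) z) \<le> k * cmod (deriv (h n) z)"
      using qc[of "{z}"] z by (auto simp: qc_pair_def elim: eventually_mono)
  qed
  have "inj_on (\<lambda>z. H z + cnj (G z)) S"
  proof (rule injective_uniform_limit[OF \<open>open S\<close>, where F = "\<lambda>n z. h n z + cnj (g n z)"])
    fix z assume z: "z \<in> S"
    have "cmod (deriv G z) < cmod (deriv H z)"
      using bd[OF z] H(2)[OF z] \<open>k < 1\<close>
      by (smt (verit) mult_less_cancel_right2 zero_less_norm_iff)
    from orientation_preserving_linear_inverse[OF this]
      harmonic_has_derivative[OF holomorphic_derivI[OF H(1) \<open>open S\<close> z] holomorphic_derivI[OF G \<open>open S\<close> z]]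
    show "\<exists>T T'. ((\<lambda>z. H z + cnj (G z)) has_derivative T) (at z) \<and> bounded_linear T' \<and>
            (\<forall>x. T' (T x) = x) \<and> (\<forall>x. T (T' x) = x)"
      by blast
  next
    fix K assume K: "compact K" "K \<subseteq> S"
    show "uniform_limit K (\<lambda>n z. h n z + cnj (g n z)) (\<lambda>z. H z + cnj (G z)) sequentially"
      by (intro uniform_limit_add limh limg K bounded_linear.uniform_limit[OF bounded_linear_cnj])
    show "\<forall>\<^sub>F n in sequentially. continuous_on K (\<lambda>z. h n z + cnj (g n z)) \<and>
            inj_on (\<lambda>z. h n z + cnj (g n z)) K"
      using qc[OF K] by eventually_elim
        (auto simp: qc_pair_def intro!: continuous_on_add continuous_on_cnj intro: holomorphic_on_imp_continuous_on)
  qed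
  with bd H G show ?thesis by (auto simp: qc_pair_def)
qed

lemma qc_pair_growth:
  assumes qc: "qc_pair k (ball 0 R) h g" and "k \<le> 1" "0 \<le> B"
    and norm: "h 0 = 0" "g 0 = 0" "deriv h 0 = 1"
    and B: "\<And>z. cmod z < R \<Longrightarrow> cmod (deriv (deriv h) z) \<le> B * cmod (deriv h z)"
    and z: "cmod z < R"
  shows "exp (- (B * cmod z)) \<le> cmod (deriv h z)" "cmod (h z) \<le> exp (B * cmod z) * cmod z"
    "cmod (g z) \<le> exp (B * cmod z) * cmod z"
proof -
  have hg: "h holomorphic_on ball 0 R" "g holomorphic_on ball 0 R"
    "\<And>w. cmod w < R \<Longrightarrow> deriv h w \<noteq> 0 \<and> cmod (deriv g w) \<le> k * cmod (deriv h w)"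
    using qc by (auto simp: qc_pair_def)
  have growth: "cmod (deriv h y) \<le> cmod (deriv h x) * exp (B * cmod (y - x))"
    if "cmod x < R" "cmod y < R" for x y
    by (rule logarithmic_derivative_growth[OF convex_ball open_ball holomorphic_deriv[OF hg(1) open_ball]])
      (use that hg(3) B in auto)
  have R: "0 < R" using z norm_ge_zero[of z] by linarith
  \<comment> \<open>The growth estimate read backwards, from \<open>z\<close> to 0, yields the lower
    bound.\<close>
  have "1 \<le> cmod (deriv h z) * exp (B * cmod z)"
    using growth[OF z, of 0] R norm by simp
  then show "exp (- (B * cmod z)) \<le> cmod (deriv h z)"
    by (simp add: exp_minus field_simps)
  have up: "cmod (deriv h w) \<le> exp (B * cmod z)" if "cmod w \<le> cmod z" for w
  proof -
    have "cmod (deriv h w) \<le> exp (B * cmod w)"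
      using growth[of 0 w] R norm that z by simp
    also have "\<dots> \<le> exp (B * cmod z)"
      using that \<open>0 \<le> B\<close> by (simp add: mult_left_mono)
    finally show ?thesis .
  qed
  have up': "cmod (deriv g w) \<le> exp (B * cmod z)" if "cmod w \<le> cmod z" for w
  proof -
    have "cmod (deriv g w) \<le> k * cmod (deriv h w)"
      using hg(3)[of w] that z by simp
    also have "\<dots> \<le> 1 * cmod (deriv h w)"
      using \<open>k \<le> 1\<close> by (intro mult_right_mono) auto
    finally show ?thesis using up[OF that] by simp
  qed
  have der: "(f has_field_derivative deriv f w) (at w within cball 0 (cmod z))"
    if "f holomorphic_on ball 0 R" "w \<in> cball 0 (cmod z)" for f w
    using holomorphic_derivI[OF that(1) open_ball] that(2) z by auto
  show "cmod (h z) \<le> exp (B * cmod z) * cmod z"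
    using field_differentiable_bound[OF convex_cball der[OF hg(1)], of "exp (B * cmod z)" z 0]
      up norm by auto
  show "cmod (g z) \<le> exp (B * cmod z) * cmod z"
    using field_differentiable_bound[OF convex_cball der[OF hg(2)], of "exp (B * cmod z)" z 0]
      up' norm by auto
qed

text \<open>Dividing \<open>g\<close> by \<open>cnj c\<close> is what divides the harmonic mapping
  \<open>h + cnj g\<close> by \<open>c\<close>; the moduli of both derivatives scale alike, so
  \<open>k\<close> is unchanged.\<close>

lemma qc_pair_rescale:
  fixes \<rho> :: real and c a :: complex
  assumes qc: "qc_pair k S h g" and "open S" "open T" "\<rho> > 0" "c \<noteq> 0"
    and sub: "\<And>w. w \<in> T \<Longrightarrow> a + of_real \<rho> * w \<in> S"
  defines "h' \<equiv> \<lambda>w. (h (a + of_real \<rho> * w) - h a) / c"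
    and "g' \<equiv> \<lambda>w. (g (a + of_real \<rho> * w) - g a) / cnj c"
  shows "qc_pair k T h' g'"
    and "\<And>w. w \<in> T \<Longrightarrow> deriv h' w = of_real \<rho> * deriv h (a + of_real \<rho> * w) / c"
    and "\<And>w. w \<in> T \<Longrightarrow> deriv (deriv h') w = (of_real \<rho>)\<^sup>2 * deriv (deriv h) (a + of_real \<rho> * w) / c"
proof -
  have hg: "h holomorphic_on S" "g holomorphic_on S" "inj_on (\<lambda>z. h z + cnj (g z)) S"
    "\<And>w. w \<in> S \<Longrightarrow> deriv h w \<noteq> 0 \<and> cmod (deriv g w) \<le> k * cmod (deriv h w)"
    using qc by (auto simp: qc_pair_def)
  have chain: "((\<lambda>w. f (a + of_real \<rho> * w)) has_field_derivative deriv f (a + of_real \<rho> * w) * of_real \<rho>) (at w)"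
    if "f holomorphic_on S" "w \<in> T" for f w
    by (rule DERIV_chain2[where f = f and g = "\<lambda>w. a + of_real \<rho> * w"])
      (auto intro!: derivative_eq_intros holomorphic_derivI[OF that(1) \<open>open S\<close>] sub[OF that(2)])
  have dh: "(h' has_field_derivative of_real \<rho> * deriv h (a + of_real \<rho> * w) / c) (at w)" if "w \<in> T" for w
    unfolding h'_def using chain[OF hg(1) that] \<open>c \<noteq> 0\<close> by (auto intro!: derivative_eq_intros simp: mult.commute)
  have dg: "(g' has_field_derivative of_real \<rho> * deriv g (a + of_real \<rho> * w) / cnj c) (at w)" if "w \<in> T" for w
    unfolding g'_def using chain[OF hg(2) that] \<open>c \<noteq> 0\<close> by (auto intro!: derivative_eq_intros simp: mult.commute)
  show dh': "deriv h' w = of_real \<rho> * deriv h (a + of_real \<rho> * w) / c" if "w \<in> T" for w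
    using dh[OF that] by (rule DERIV_imp_deriv)
  show "deriv (deriv h') w = (of_real \<rho>)\<^sup>2 * deriv (deriv h) (a + of_real \<rho> * w) / c" if "w \<in> T" for w
  proof (rule DERIV_imp_deriv, rule has_field_derivative_transform_within_open[OF _ \<open>open T\<close> that dh'[symmetric]])
    show "((\<lambda>w. of_real \<rho> * deriv h (a + of_real \<rho> * w) / c) has_field_derivative
            (of_real \<rho>)\<^sup>2 * deriv (deriv h) (a + of_real \<rho> * w) / c) (at w)"
      using chain[OF holomorphic_deriv[OF hg(1) \<open>open S\<close>] that] \<open>c \<noteq> 0\<close>
      by (auto intro!: derivative_eq_intros simp: power2_eq_square)
  qed
  have "inj_on (\<lambda>w. h' w + cnj (g' w)) T"
  proof (rule inj_onI)
    fix x y assume xy: "x \<in> T" "y \<in> T" "h' x + cnj (g' x) = h' y + cnj (g' y)"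
    have eq: "h' w + cnj (g' w) = (h (a + of_real \<rho> * w) + cnj (g (a + of_real \<rho> * w)) - (h a + cnj (g a))) / c" for w
      by (simp add: h'_def g'_def add_divide_distrib diff_divide_distrib)
    have "h (a + of_real \<rho> * x) + cnj (g (a + of_real \<rho> * x))
        = h (a + of_real \<rho> * y) + cnj (g (a + of_real \<rho> * y))"
      using xy(3)[unfolded eq] \<open>c \<noteq> 0\<close> by simp
    from inj_onD[OF hg(3) this sub[OF xy(1)] sub[OF xy(2)]] show "x = y"
      using \<open>\<rho> > 0\<close> by simp
  qed
  moreover have "h' holomorphic_on T" "g' holomorphic_on T"
    using dh dg \<open>open T\<close> by (auto simp: holomorphic_on_open)
  moreover have "deriv h' w \<noteq> 0 \<and> cmod (deriv g' w) \<le> k * cmod (deriv h' w)" if "w \<in> T" for w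
  proof -
    have "\<rho> * cmod (deriv g (a + of_real \<rho> * w)) / cmod c \<le> \<rho> * (k * cmod (deriv h (a + of_real \<rho> * w))) / cmod c"
      using hg(4)[OF sub[OF that]] \<open>\<rho> > 0\<close> by (intro divide_right_mono mult_left_mono) auto
    then show ?thesis
      using hg(4)[OF sub[OF that]] \<open>\<rho> > 0\<close> \<open>c \<noteq> 0\<close>
      by (simp add: dh'[OF that] DERIV_imp_deriv[OF dg[OF that]] norm_mult norm_divide mult_ac)
  qed
  ultimately show "qc_pair k T h' g'" by (simp add: qc_pair_def)
qed

section \<open>Rescaling, the bound on h'' / h', and compactness\<close>

text \<open>Zooming in at a maximum point \<open>\<zeta>\<close> of the weighted quotient
  \<open>q\<close> normalizes the modulus of h'' / h' to 1 at the center. Maximality keeps it at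
  most 2 on a ball whose radius grows with \<open>N\<close>.\<close>

lemma qc_pair_extremal_rescaling:
  assumes qc: "qc_pair k unit_disk h g" and "N > 0"
    and big: "cmod (deriv (deriv h) 0) > N * cmod (deriv h 0)"
  shows "\<exists>h g. qc_pair k (ball 0 (N / 4)) h g \<and> h 0 = 0 \<and> g 0 = 0 \<and> deriv h 0 = 1 \<and>
           cmod (deriv (deriv h) 0) = 1 \<and>
           (\<forall>z. cmod z < N / 4 \<longrightarrow> cmod (deriv (deriv h) z) \<le> 2 * cmod (deriv h z))"
proof -
  have hol: "h holomorphic_on unit_disk" and nz: "\<And>z. z \<in> unit_disk \<Longrightarrow> deriv h z \<noteq> 0"
    using qc by (auto simp: qc_pair_def)
  define p where "p = (\<lambda>z. cmod (deriv (deriv h) z / deriv h z))"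
  \<comment> \<open>The radius 1/2 gives a compact disk inside the domain. The weight vanishes on
    its boundary, so a positive maximum is taken in the interior.\<close>
  define q where "q = (\<lambda>z. (1 / 2 - cmod z) * p z)"
  have "(\<lambda>z. deriv (deriv h) z / deriv h z) holomorphic_on unit_disk"
    using hol nz by (intro holomorphic_intros) auto
  then have "continuous_on (cball 0 (1 / 2)) (\<lambda>z. deriv (deriv h) z / deriv h z)"
    by (rule continuous_on_subset[OF holomorphic_on_imp_continuous_on]) auto
  then have "continuous_on (cball 0 (1 / 2)) q"
    unfolding q_def p_def
    by (intro continuous_on_mult continuous_on_norm continuous_on_diff continuous_on_const continuous_on_id)
  then obtain \<zeta> where \<zeta>: "\<zeta> \<in> cball 0 (1 / 2)" "\<And>z. z \<in> cball 0 (1 / 2) \<Longrightarrow> q z \<le> q \<zeta>"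
    using continuous_attains_sup[OF compact_cball, of 0 "1 / 2" q] by auto
  have "N < p 0"
    using big nz[of 0] by (simp add: p_def norm_divide field_simps)
  then have "N / 2 < q 0" by (simp add: q_def)
  with \<zeta>(2)[of 0] have q\<zeta>: "N / 2 < q \<zeta>" by simp
  have p\<zeta>: "p \<zeta> > 0" "cmod \<zeta> < 1 / 2"
  proof -
    have "q \<zeta> \<noteq> 0" using q\<zeta> \<open>N > 0\<close> by linarith
    then have "p \<zeta> \<noteq> 0" "cmod \<zeta> \<noteq> 1 / 2" by (auto simp: q_def)
    with \<zeta>(1) show "p \<zeta> > 0" "cmod \<zeta> < 1 / 2" by (auto simp: p_def)
  qed
  define \<rho> where "\<rho> = 1 / p \<zeta>"
  have \<rho>: "\<rho> > 0" "N * \<rho> < 1 - 2 * cmod \<zeta>"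
    using p\<zeta> q\<zeta> by (auto simp: \<rho>_def q_def field_simps)
  \<comment> \<open>The displacement is below \<open>\<rho> * N / 4\<close>, which is less than half
    the distance from \<open>\<zeta>\<close> to the circle of radius 1/2, so the weight drops by
    less than a factor 2.\<close>
  have near: "1 / 2 - cmod \<zeta> < 2 * (1 / 2 - cmod (\<zeta> + of_real \<rho> * w))" if "cmod w < N / 4" for w
  proof -
    have "cmod (\<zeta> + of_real \<rho> * w) \<le> cmod \<zeta> + \<rho> * cmod w"
      using norm_triangle_ineq[of \<zeta> "of_real \<rho> * w"] \<rho>(1) by (simp add: norm_mult)
    moreover have "\<rho> * cmod w < \<rho> * (N / 4)"
      using that \<rho>(1) by simp
    ultimately show ?thesis using \<rho>(2) by (simp add: mult.commute)
  qed
  have ind: "\<zeta> + of_real \<rho> * w \<in> cball 0 (1 / 2)" if "w \<in> ball 0 (N / 4)" for w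
    using near[of w] that p\<zeta>(2) by simp
  have in_disk: "\<zeta> + of_real \<rho> * w \<in> unit_disk" if "w \<in> ball 0 (N / 4)" for w
    using ind[OF that] by simp
  define c where "c = of_real \<rho> * deriv h \<zeta>"
  have c: "c \<noteq> 0" using \<rho>(1) nz[of \<zeta>] p\<zeta>(2) by (simp add: c_def)
  define h' where "h' = (\<lambda>w. (h (\<zeta> + of_real \<rho> * w) - h \<zeta>) / c)"
  define g' where "g' = (\<lambda>w. (g (\<zeta> + of_real \<rho> * w) - g \<zeta>) / cnj c)"
  have qc': "qc_pair k (ball 0 (N / 4)) h' g'"
    unfolding h'_def g'_def
    by (rule qc_pair_rescale(1)[OF qc open_ball open_ball \<rho>(1) c]) (rule in_disk)
  have d1': "deriv h' w = of_real \<rho> * deriv h (\<zeta> + of_real \<rho> * w) / c"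
    and d2': "deriv (deriv h') w = (of_real \<rho>)\<^sup>2 * deriv (deriv h) (\<zeta> + of_real \<rho> * w) / c"
    if "w \<in> ball 0 (N / 4)" for w
    unfolding h'_def
    by (rule qc_pair_rescale(2,3)[OF qc open_ball open_ball[of 0 "N / 4"] \<rho>(1) c]; use in_disk that in blast)+
  have dh: "cmod (deriv (deriv h') w) = \<rho> * p (\<zeta> + of_real \<rho> * w) * cmod (deriv h' w)"
    if "w \<in> ball 0 (N / 4)" for w
    using nz[OF in_disk[OF that]] \<rho>(1)
    by (simp add: d1'[OF that] d2'[OF that] p_def norm_mult norm_divide power2_eq_square)
  have zero: "(0::complex) \<in> ball 0 (N / 4)" using \<open>N > 0\<close> by simp
  have d1: "deriv h' 0 = 1"
    using d1'[OF zero] c by (simp add: c_def)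
  moreover have "cmod (deriv (deriv h') 0) = 1"
    using dh[OF zero] d1 p\<zeta>(1) by (simp add: \<rho>_def)
  moreover have "cmod (deriv (deriv h') w) \<le> 2 * cmod (deriv h' w)" if w: "cmod w < N / 4" for w
  proof -
    let ?z = "\<zeta> + of_real \<rho> * w"
    have "(1 / 2 - cmod ?z) * p ?z \<le> (1 / 2 - cmod \<zeta>) * p \<zeta>"
      using \<zeta>(2)[OF ind[of w]] w by (simp add: q_def)
    also have "\<dots> \<le> 2 * (1 / 2 - cmod ?z) * p \<zeta>"
      using near[OF w] p\<zeta>(1) by (intro mult_right_mono) auto
    finally have "(1 / 2 - cmod ?z) * p ?z \<le> (1 / 2 - cmod ?z) * (2 * p \<zeta>)" by (simp only: mult_ac)
    moreover have "0 < 1 / 2 - cmod ?z"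
    proof -
      have "0 < 1 / 2 - cmod \<zeta>" using p\<zeta>(2) by simp
      also note near[OF w]
      finally show ?thesis by simp
    qed
    ultimately have "p ?z \<le> 2 * p \<zeta>" by (simp only: mult_le_cancel_left_pos)
    then have "\<rho> * p ?z \<le> 2"
      using p\<zeta>(1) by (simp add: \<rho>_def field_simps)
    with dh[of w] w show ?thesis by (simp add: mult_right_mono)
  qed
  moreover have "h' 0 = 0" "g' 0 = 0" by (simp_all add: h'_def g'_def)
  ultimately show ?thesis using qc' by blast
qed

text \<open>If no constant worked, rescaled counterexamples would converge to a pair on the whole
  plane with second derivative of modulus 1 at 0, while Liouville's theorem forces its analytic part
  to be affine.\<close>

lemma pre_schwarzian_bound:
  assumes "k < 1"
  shows "\<exists>\<alpha>\<ge>0. \<forall>h g. qc_pair k unit_disk h g \<longrightarrow>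
           cmod (deriv (deriv h) 0) \<le> \<alpha> * cmod (deriv h 0)"
proof (rule ccontr)
  assume neg: "\<not> ?thesis"
  have "\<exists>h g. qc_pair k (ball 0 (real (Suc n) / 4)) h g \<and> h 0 = 0 \<and> g 0 = 0 \<and> deriv h 0 = 1 \<and>
           cmod (deriv (deriv h) 0) = 1 \<and>
           (\<forall>z. cmod z < real (Suc n) / 4 \<longrightarrow> cmod (deriv (deriv h) z) \<le> 2 * cmod (deriv h z))" for n
  proof -
    obtain h g where "qc_pair k unit_disk h g" "\<not> cmod (deriv (deriv h) 0) \<le> real (Suc n) * cmod (deriv h 0)"
      using neg by (meson of_nat_0_le_iff)
    then show ?thesis by (intro qc_pair_extremal_rescaling[of k h g]) auto
  qed
  then obtain h g where qc: "\<And>n. qc_pair k (ball 0 (real (Suc n) / 4)) (h n) (g n)"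
    and norm: "\<And>n. h n 0 = 0" "\<And>n. g n 0 = 0" "\<And>n. deriv (h n) 0 = 1"
      "\<And>n. cmod (deriv (deriv (h n)) 0) = 1"
    and bd: "\<And>n z. cmod z < real (Suc n) / 4 \<Longrightarrow> cmod (deriv (deriv (h n)) z) \<le> 2 * cmod (deriv (h n) z)"
    by metis
  define M where "M = (\<lambda>n. real (Suc n) / 4)"
  have M: "filterlim M at_top sequentially"
    unfolding M_def by real_asymp
  have growth: "exp (- (2 * cmod z)) \<le> cmod (deriv (h n) z)" "cmod (h n z) \<le> exp (2 * cmod z) * cmod z"
    "cmod (g n z) \<le> exp (2 * cmod z) * cmod z" if "cmod z < M n" for n z
    \<comment> \<open>The bound 2 on the rescaled quotient h'' / h' makes these estimates
      independent of \<open>n\<close>.\<close>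
    using qc_pair_growth[OF qc _ _ norm(1-3) bd, of n z] that \<open>k < 1\<close> by (simp_all add: M_def)
  have hol: "h n holomorphic_on ball 0 (M n)" "g n holomorphic_on ball 0 (M n)" for n
    using qc[of n] by (auto simp: qc_pair_def M_def)
  have mono: "exp (2 * x) * x \<le> exp (2 * R) * R" if "0 \<le> x" "x \<le> R" for x R :: real
    using that by (intro mult_mono) auto
  have bdh: "\<exists>B. \<forall>n z. cmod z \<le> R \<and> cmod z < M n \<longrightarrow> cmod (h n z) \<le> B" for R
    using growth(2) mono by (meson norm_ge_zero order_trans)
  have bdg: "\<exists>B. \<forall>n z. cmod z \<le> R \<and> cmod z < M n \<longrightarrow> cmod (g n z) \<le> B" for R
    using growth(3) mono by (meson norm_ge_zero order_trans)
  obtain r H where r: "strict_mono (r :: nat \<Rightarrow> nat)" and H: "H holomorphic_on UNIV"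
    and limH: "\<And>K. compact K \<Longrightarrow> uniform_limit K (\<lambda>n. h (r n)) H sequentially"
    using Montel_growing_balls[OF hol(1) M bdh] by metis
  have Mr: "filterlim (\<lambda>n. M (r n)) at_top sequentially"
    by (rule filterlim_compose[OF M filterlim_subseq[OF r]])
  have "\<exists>B. \<forall>n z. cmod z \<le> R \<and> cmod z < M (r n) \<longrightarrow> cmod (g (r n) z) \<le> B" for R
    using bdg[of R] by blast
  from Montel_growing_balls[OF hol(2) Mr this]
  obtain s G where s: "strict_mono (s :: nat \<Rightarrow> nat)" and G: "G holomorphic_on UNIV"
    and limG: "\<And>K. compact K \<Longrightarrow> uniform_limit K (\<lambda>n. g (r (s n))) G sequentially"
    by metis
  have limH': "uniform_limit K (\<lambda>n. h (r (s n))) H sequentially" if "compact K" for K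
    by (rule filterlim_compose[OF limH[OF that] filterlim_subseq[OF s]])
  have Ms: "filterlim (\<lambda>n. M (r (s n))) at_top sequentially"
    by (rule filterlim_compose[OF Mr filterlim_subseq[OF s]])
  have large: "\<forall>\<^sub>F n in sequentially. K \<subseteq> ball 0 (M (r (s n)))" if K: "compact K" for K :: "complex set"
  proof -
    obtain B where B: "\<And>z. z \<in> K \<Longrightarrow> cmod z \<le> B"
      using compact_imp_bounded[OF K] by (auto simp: bounded_iff)
    have "\<forall>\<^sub>F n in sequentially. B < M (r (s n))"
      using Ms by (simp add: filterlim_at_top_dense)
    then show ?thesis by eventually_elim (use B in force)
  qed
  have qcK: "\<forall>\<^sub>F n in sequentially. qc_pair k K (h (r (s n))) (g (r (s n)))" if "compact K" for K
    using large[OF that] by eventually_elim (use qc in \<open>auto simp: M_def intro: qc_pair_subset\<close>)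
  have holK: "\<forall>\<^sub>F n in sequentially. h (r (s n)) holomorphic_on K" if "compact K" for K
    using qcK[OF that] by eventually_elim (simp add: qc_pair_def)
  have derlim: "(\<lambda>n. (deriv ^^ m) (h (r (s n))) z) \<longlonglongrightarrow> (deriv ^^ m) H z" for m z
    by (rule higher_deriv_compact_limit[OF open_UNIV UNIV_I limH' holK])
  have H1: "deriv H z \<noteq> 0" for z
  proof -
    have "(\<lambda>n. cmod ((deriv ^^ 1) (h (r (s n))) z)) \<longlonglongrightarrow> cmod ((deriv ^^ 1) H z)"
      by (intro tendsto_norm derlim)
    moreover have "\<forall>\<^sub>F n in sequentially. exp (- (2 * cmod z)) \<le> cmod ((deriv ^^ 1) (h (r (s n))) z)"
      using large[of "{z}"] by (auto elim!: eventually_mono intro: growth(1))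
    ultimately have "exp (- (2 * cmod z)) \<le> cmod ((deriv ^^ 1) H z)"
      by (intro tendsto_lowerbound) auto
    then show ?thesis by (auto simp: not_le)
  qed
  \<comment> \<open>The normalization at 0 survives in the limit; this is the fact contradicted at
    the end.\<close>
  have H2: "cmod (deriv (deriv H) 0) = 1"
  proof -
    have "(\<lambda>n. cmod ((deriv ^^ 2) (h (r (s n))) 0)) \<longlonglongrightarrow> cmod ((deriv ^^ 2) H 0)"
      by (intro tendsto_norm derlim)
    then show ?thesis
      using norm(4) by (simp add: numeral_2_eq_2 LIMSEQ_const_iff)
  qed
  have qcH: "qc_pair k UNIV H G"
    by (rule qc_pair_limit[OF \<open>k < 1\<close> open_UNIV H H1 G limH' limG qcK])
  have "(\<lambda>z. deriv G z / deriv H z) constant_on UNIV"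
  proof (rule Liouville_theorem)
    show "(\<lambda>z. deriv G z / deriv H z) holomorphic_on UNIV"
      using G H H1 by (intro holomorphic_intros) auto
    have "cmod (deriv G z / deriv H z) \<le> k" for z
      using qcH H1[of z] by (simp add: qc_pair_def norm_divide divide_le_eq)
    then show "bounded (range (\<lambda>z. deriv G z / deriv H z))"
      by (auto simp: bounded_iff)
  qed
  then obtain c where "\<And>z. deriv G z / deriv H z = c"
    by (auto simp: constant_on_def)
  then have c: "deriv G z = c * deriv H z" for z
    using H1[of z] by (metis nonzero_divide_eq_eq)
  have "((\<lambda>z. G z - c * H z) has_field_derivative 0) (at z)" for z
    using holomorphic_derivI[OF G open_UNIV UNIV_I, of z] holomorphic_derivI[OF H open_UNIV UNIV_I, of z] c[of z]
    by (auto intro!: derivative_eq_intros)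
  then obtain d where d: "\<And>z. G z - c * H z = d"
    using has_field_derivative_zero_constant[OF convex_UNIV, of "\<lambda>z. G z - c * H z"] by auto
  \<comment> \<open>As \<open>G\<close> equals \<open>c * H + d\<close>, the value of
    \<open>H\<close> determines that of the injective harmonic mapping.\<close>
  have "inj H"
  proof (rule injI)
    fix x y assume xy: "H x = H y"
    have "G x - c * H x = G y - c * H y" using d by simp
    with xy have "H x + cnj (G x) = H y + cnj (G y)" by simp
    moreover have "inj (\<lambda>z. H z + cnj (G z))" using qcH by (simp add: qc_pair_def)
    ultimately show "x = y" by (rule injD[rotated])
  qed
  have Heq: "H = (\<lambda>z. H 0 + deriv H 0 * z)"
    by (rule ext, rule injective_entire_affine[OF H \<open>inj H\<close>])
  have "((\<lambda>z. H 0 + deriv H 0 * z) has_field_derivative deriv H 0) (at z)" for z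
    by (auto intro!: derivative_eq_intros)
  then have dH: "deriv H z = deriv H 0" for z
    unfolding Heq[symmetric] by (rule DERIV_imp_deriv)
  have "(deriv H has_field_derivative 0) (at 0)"
    by (rule has_field_derivative_transform_within_open[OF DERIV_const open_UNIV UNIV_I dH[symmetric]])
  then have "deriv (deriv H) 0 = 0" by (rule DERIV_imp_deriv)
  with H2 show False by simp
qed

text \<open>The bound at 0 is carried to other points by rescaling smaller disks to the unit disk.
  Integrated, it gives locally uniform bounds for Montel's theorem and a lower bound on derivatives
  that prevents degenerate limits.\<close>

lemma qc_pair_compact:
  assumes "k < 1" and qc: "\<And>n. qc_pair k unit_disk (h n) (g n)"
    and norm: "\<And>n. h n 0 = 0" "\<And>n. g n 0 = 0" "\<And>n. deriv (h n) 0 = 1"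
  obtains r H G where "strict_mono (r :: nat \<Rightarrow> nat)" "qc_pair k unit_disk H G"
    "H 0 = 0" "G 0 = 0" "deriv H 0 = 1"
    "\<And>K. compact K \<Longrightarrow> K \<subseteq> unit_disk \<Longrightarrow> uniform_limit K (\<lambda>n. h (r n)) H sequentially"
    "\<And>K. compact K \<Longrightarrow> K \<subseteq> unit_disk \<Longrightarrow> uniform_limit K (\<lambda>n. g (r n)) G sequentially"
proof -
  obtain \<alpha> where \<alpha>: "\<alpha> \<ge> 0"
    "\<And>h g. qc_pair k unit_disk h g \<Longrightarrow> cmod (deriv (deriv h) 0) \<le> \<alpha> * cmod (deriv h 0)"
    using pre_schwarzian_bound[OF \<open>k < 1\<close>] by blast
  have bd: "cmod (deriv (deriv (h n)) z) \<le> \<alpha> / (1 - s) * cmod (deriv (h n) z)"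
    if z: "cmod z < s" "s < 1" for n z s
  proof -
    \<comment> \<open>The disk of radius \<open>1 - s\<close> about \<open>z\<close> stays in the
      unit disk because \<open>cmod z < s\<close>; rescaling multiplies h'' / h' by this
      radius.\<close>
    define \<rho> where "\<rho> = 1 - s"
    have \<rho>: "\<rho> > 0" using z by (simp add: \<rho>_def)
    have sub: "z + of_real \<rho> * w \<in> unit_disk" if "w \<in> unit_disk" for w
    proof -
      have "cmod (z + of_real \<rho> * w) \<le> cmod z + \<rho> * cmod w"
        using norm_triangle_ineq[of z "of_real \<rho> * w"] \<rho> by (simp add: norm_mult)
      also have "\<dots> < s + \<rho> * 1"
        using that z \<rho> by (intro add_less_le_mono mult_left_mono) auto
      finally show ?thesis by (simp add: \<rho>_def)
    qed
    note resc = qc_pair_rescale[OF qc[of n] open_ball open_ball[of 0 1] \<rho>, of 1 z]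
    have "cmod ((of_real \<rho>)\<^sup>2 * deriv (deriv (h n)) (z + of_real \<rho> * 0) / 1)
        \<le> \<alpha> * cmod (of_real \<rho> * deriv (h n) (z + of_real \<rho> * 0) / 1)"
      using \<alpha>(2)[OF resc(1)] resc(2,3)[of 0] sub by simp
    then have "\<rho> * (\<rho> * cmod (deriv (deriv (h n)) z)) \<le> \<rho> * (\<alpha> * cmod (deriv (h n) z))"
      using \<rho> by (simp add: norm_mult norm_power power2_eq_square mult_ac)
    then have "\<rho> * cmod (deriv (deriv (h n)) z) \<le> \<alpha> * cmod (deriv (h n) z)"
      using \<rho> by simp
    then show ?thesis using \<rho> by (simp add: \<rho>_def field_simps)
  qed
  have growth: "exp (- (\<alpha> / (1 - s) * cmod z)) \<le> cmod (deriv (h n) z)"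
    "cmod (h n z) \<le> exp (\<alpha> / (1 - s) * cmod z) * cmod z"
    "cmod (g n z) \<le> exp (\<alpha> / (1 - s) * cmod z) * cmod z" if "cmod z < s" "s < 1" for n z s
  proof -
    have "qc_pair k (ball 0 s) (h n) (g n)"
      using \<open>s < 1\<close> by (intro qc_pair_subset[OF qc]) auto
    from qc_pair_growth[OF this _ _ norm bd[OF _ \<open>s < 1\<close>] that(1)] \<alpha>(1) that(2) \<open>k < 1\<close>
    show "exp (- (\<alpha> / (1 - s) * cmod z)) \<le> cmod (deriv (h n) z)"
      "cmod (h n z) \<le> exp (\<alpha> / (1 - s) * cmod z) * cmod z"
      "cmod (g n z) \<le> exp (\<alpha> / (1 - s) * cmod z) * cmod z" by auto
  qed
  have hol: "h n holomorphic_on unit_disk" "g n holomorphic_on unit_disk" for n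
    using qc[of n] by (auto simp: qc_pair_def)
  have bdK: "\<exists>B. \<forall>n. \<forall>z\<in>K. cmod (h n z) \<le> B \<and> cmod (g n z) \<le> B"
    if K: "compact K" "K \<subseteq> unit_disk" for K
  proof -
    obtain s where s: "K \<subseteq> ball 0 s" "s < 1" "0 < s"
    proof (cases "K = {}")
      case True then show ?thesis using that[of "1 / 2"] by simp
    next
      case False
      obtain x where x: "x \<in> K" "\<And>y. y \<in> K \<Longrightarrow> cmod y \<le> cmod x"
        using continuous_attains_sup[OF K(1) False, of cmod] by (auto intro: continuous_intros)
      have "cmod x < 1" using x(1) K(2) by auto
      have "cmod y < (1 + cmod x) / 2" if "y \<in> K" for y
        using x(2)[OF that] \<open>cmod x < 1\<close> by simp
      then have "K \<subseteq> ball 0 ((1 + cmod x) / 2)" by auto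
      moreover have "0 < (1 + cmod x) / 2" by (simp add: add_pos_nonneg)
      ultimately show ?thesis
        using that \<open>cmod x < 1\<close> by simp
    qed
    have "exp (\<alpha> / (1 - s) * cmod z) * cmod z \<le> exp (\<alpha> / (1 - s) * 1) * 1" if "z \<in> K" for z
      using s that \<alpha>(1) by (intro mult_mono) (auto intro!: divide_right_mono mult_left_le)
    then show ?thesis
      using growth(2,3)[OF _ s(2)] s(1) by (meson mem_ball_0 order_trans subsetD)
  qed
  obtain H r where H: "H holomorphic_on unit_disk" and r: "strict_mono (r :: nat \<Rightarrow> nat)"
    and limH: "\<And>K. \<lbrakk>compact K; K \<subseteq> unit_disk\<rbrakk> \<Longrightarrow> uniform_limit K (h \<circ> r) H sequentially"
  proof (rule Montel[OF open_ball[of 0 1], of "range h" h])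
    show "f holomorphic_on unit_disk" if "f \<in> range h" for f using that hol by blast
    show "\<exists>B. \<forall>f\<in>range h. \<forall>z\<in>K. cmod (f z) \<le> B"
      if "compact K" "K \<subseteq> unit_disk" for K using bdK[OF that] by blast
  qed (simp, use that in blast)
  obtain G s where G: "G holomorphic_on unit_disk" and s: "strict_mono (s :: nat \<Rightarrow> nat)"
    and limG: "\<And>K. \<lbrakk>compact K; K \<subseteq> unit_disk\<rbrakk> \<Longrightarrow> uniform_limit K ((\<lambda>n. g (r n)) \<circ> s) G sequentially"
  proof (rule Montel[OF open_ball[of 0 1], of "range (\<lambda>n. g (r n))" "\<lambda>n. g (r n)"])
    show "f holomorphic_on unit_disk" if "f \<in> range (\<lambda>n. g (r n))" for f using that hol by blast
    show "\<exists>B. \<forall>f\<in>range (\<lambda>n. g (r n)). \<forall>z\<in>K. cmod (f z) \<le> B"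
      if "compact K" "K \<subseteq> unit_disk" for K using bdK[OF that] by blast
  qed (simp, use that in blast)
  have rs: "strict_mono (r \<circ> s)" by (rule strict_mono_o[OF r s])
  have limH': "uniform_limit K (\<lambda>n. h ((r \<circ> s) n)) H sequentially" if "compact K" "K \<subseteq> unit_disk" for K
    using filterlim_compose[OF limH[OF that] filterlim_subseq[OF s]] by (simp add: o_def)
  have limG': "uniform_limit K (\<lambda>n. g ((r \<circ> s) n)) G sequentially" if "compact K" "K \<subseteq> unit_disk" for K
    using limG[OF that] by (simp add: o_def)
  have holK: "\<forall>\<^sub>F n in sequentially. h ((r \<circ> s) n) holomorphic_on K" if "compact K" "K \<subseteq> unit_disk" for K
    using hol(1) that(2) by (auto intro!: always_eventually intro: holomorphic_on_subset)
  have derlim: "(\<lambda>n. deriv (h ((r \<circ> s) n)) z) \<longlonglongrightarrow> deriv H z" if "z \<in> unit_disk" for z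
    using higher_deriv_compact_limit[OF open_ball that limH' holK, of 1] by simp
  have H1: "deriv H z \<noteq> 0" if z: "z \<in> unit_disk" for z
  proof -
    have "(\<lambda>n. cmod (deriv (h ((r \<circ> s) n)) z)) \<longlonglongrightarrow> cmod (deriv H z)"
      by (intro tendsto_norm derlim z)
    \<comment> \<open>Here \<open>s\<close> is the midpoint \<open>(1 + cmod z) / 2\<close> between
      \<open>cmod z\<close> and 1.\<close>
    moreover have "exp (- (\<alpha> / (1 - (1 + cmod z) / 2) * cmod z)) \<le> cmod (deriv (h n) z)" for n
      by (rule growth(1)) (use z in auto)
    ultimately have "exp (- (\<alpha> / (1 - (1 + cmod z) / 2) * cmod z)) \<le> cmod (deriv H z)"
      by (intro tendsto_lowerbound[where F = sequentially]) auto
    then show ?thesis by (auto simp: not_le)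
  qed
  have "qc_pair k unit_disk H G"
    by (rule qc_pair_limit[OF \<open>k < 1\<close> open_ball H H1 G limH' limG'])
      (use qc in \<open>auto intro!: always_eventually intro: qc_pair_subset\<close>)
  moreover have "H 0 = 0" "G 0 = 0" "deriv H 0 = 1"
    using limH'[of "{0}"] limG'[of "{0}"] derlim[of 0] norm by (simp_all add: LIMSEQ_const_iff)
  ultimately show ?thesis using that[OF rs] limH' limG' by blast
qed

subsection \<open>Dilatations and balanced representatives\<close>

lemma analytic_parts_has_derivative:
  assumes "analytic_parts f h g" "z \<in> unit_disk"
  shows "(f has_derivative (\<lambda>t. deriv h z * t + cnj (deriv g z * t))) (at z)"
proof (rule has_derivative_transform_within_open[OF _ open_ball assms(2)])
  show "((\<lambda>z. h z + cnj (g z)) has_derivative (\<lambda>t. deriv h z * t + cnj (deriv g z * t))) (at z)"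
    using assms by (intro harmonic_has_derivative holomorphic_derivI[OF _ open_ball])
      (auto simp: analytic_parts_def)
qed (use assms(1) in \<open>simp add: analytic_parts_def\<close>)

lemma wirtinger_analytic_parts:
  assumes "analytic_parts f h g" "z \<in> unit_disk"
  shows "wirtinger f z = deriv h z"
  unfolding wirtinger_def frechet_derivative_at[OF analytic_parts_has_derivative[OF assms], symmetric]
  by (simp add: algebra_simps)

text \<open>The real derivative of \<open>f\<close> determines both coefficients: the Wirtinger
  derivative gives the first, and subtraction the second. This makes the definite description in
  \<open>dilatation\<close> meaningful.\<close>

lemma analytic_parts_deriv_unique:
  assumes "analytic_parts f h g" "analytic_parts f h' g'" "z \<in> unit_disk"
  shows "deriv h' z = deriv h z" "deriv g' z = deriv g z"
proof -
  have eq: "deriv h' z * t + cnj (deriv g' z * t) = deriv h z * t + cnj (deriv g z * t)" for t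
    using has_derivative_unique[OF analytic_parts_has_derivative[OF assms(1,3)]
      analytic_parts_has_derivative[OF assms(2,3)]] by (metis (no_types, lifting))
  show h: "deriv h' z = deriv h z"
    using wirtinger_analytic_parts assms by metis
  show "deriv g' z = deriv g z" using eq[of 1] h by simp
qed

lemma dilatation_eq:
  assumes "analytic_parts f h g" "z \<in> unit_disk"
  shows "dilatation f z = deriv g z / deriv h z"
  unfolding dilatation_def
proof (rule the_equality)
  show "\<exists>h' g'. analytic_parts f h' g' \<and> deriv g z / deriv h z = deriv g' z / deriv h' z"
    using assms(1) by blast
next
  fix w assume "\<exists>h' g'. analytic_parts f h' g' \<and> w = deriv g' z / deriv h' z"
  then show "w = deriv g z / deriv h z"
    using analytic_parts_deriv_unique[OF assms(1) _ assms(2)] by auto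
qed

lemma op_harmonicE:
  assumes "op_harmonic f"
  obtains h g where "analytic_parts f h g" "\<And>z. z \<in> unit_disk \<Longrightarrow> deriv h z \<noteq> 0"
    "\<And>z. z \<in> unit_disk \<Longrightarrow> cmod (dilatation f z) < 1"
proof -
  from assms obtain h g where hg: "analytic_parts f h g"
    "\<And>z. z \<in> unit_disk \<Longrightarrow> 0 < (cmod (deriv h z))\<^sup>2 - (cmod (deriv g z))\<^sup>2"
    unfolding op_harmonic_def by blast
  have lt: "cmod (deriv g z) < cmod (deriv h z)" if "z \<in> unit_disk" for z
  proof (rule power2_less_imp_less)
    show "(cmod (deriv g z))\<^sup>2 < (cmod (deriv h z))\<^sup>2" using hg(2)[OF that] by simp
  qed simp
  show ?thesis
  proof (rule that[OF hg(1)])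
    fix z :: complex assume z: "z \<in> unit_disk"
    show "deriv h z \<noteq> 0" using lt[OF z] by auto
    then show "cmod (dilatation f z) < 1"
      using lt[OF z] by (simp add: dilatation_eq[OF hg(1) z] norm_divide)
  qed
qed

text \<open>The closure lies in the closed disk of radius \<open>sup_norm (dilatation f)\<close>,
  which is below 1. Boundedness of the dilatation by 1 ensures that this real supremum dominates the
  values.\<close>

lemma dilatation_range:
  assumes "op_harmonic f" "sup_norm (dilatation f) < 1"
  shows "compact (closure (dilatation f ` unit_disk))" "closure (dilatation f ` unit_disk) \<noteq> {}"
    "closure (dilatation f ` unit_disk) \<subseteq> unit_disk"
proof -
  have lt1: "cmod (dilatation f z) < 1" if "z \<in> unit_disk" for z
    by (rule op_harmonicE[OF assms(1)]) (use that in blast)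
  have "bdd_above ((\<lambda>z. cmod (dilatation f z)) ` unit_disk)"
    using lt1 by (intro bdd_aboveI[of _ 1]) (auto intro: less_imp_le)
  then have "cmod (dilatation f z) \<le> sup_norm (dilatation f)" if "z \<in> unit_disk" for z
    unfolding sup_norm_def using that by (intro cSUP_upper)
  then have "closure (dilatation f ` unit_disk) \<subseteq> cball 0 (sup_norm (dilatation f))"
    by (intro closure_minimal) auto
  then show "closure (dilatation f ` unit_disk) \<subseteq> unit_disk"
    "compact (closure (dilatation f ` unit_disk))"
    using assms(2) by (auto simp: compact_eq_bounded_closed intro: bounded_subset[OF bounded_cball])
  show "closure (dilatation f ` unit_disk) \<noteq> {}" by simp
qed

lemma closure_continuous_image_compact:
  fixes T :: "'a::t2_space \<Rightarrow> 'b::t2_space"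
  assumes "compact (closure X)" "continuous_on (closure X) T"
  shows "closure (T ` X) = T ` closure X"
proof
  have "closed (T ` closure X)"
    by (intro compact_imp_closed compact_continuous_image assms)
  then show "closure (T ` X) \<subseteq> T ` closure X"
    by (intro closure_minimal image_mono closure_subset)
  show "T ` closure X \<subseteq> closure (T ` X)"
    by (rule image_closure_subset[OF assms(2) closed_closure closure_subset])
qed

section \<open>Affine post-composition and the balanced representative\<close>

lemma affine_analytic_parts:
  assumes "analytic_parts f h g"
  shows "analytic_parts ((\<lambda>w. a * w + b * cnj w + c) \<circ> f)
           (\<lambda>z. a * h z + b * g z + c) (\<lambda>z. cnj a * g z + cnj b * h z)"
  using assms unfolding analytic_parts_def
  by (auto intro!: holomorphic_intros simp: algebra_simps)

lemma affine_dilatation: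
  assumes f: "op_harmonic f" and z: "z \<in> unit_disk"
  shows "dilatation ((\<lambda>w. a * w + b * cnj w + c) \<circ> f) z = mobius a b (dilatation f z)"
proof -
  obtain h g where hg: "analytic_parts f h g" and nz: "deriv h z \<noteq> 0"
    by (rule op_harmonicE[OF f]) (use z in blast)
  have d: "(h has_field_derivative deriv h z) (at z)" "(g has_field_derivative deriv g z) (at z)"
    using hg z by (auto simp: analytic_parts_def intro!: holomorphic_derivI[OF _ open_ball])
  have "deriv (\<lambda>z. a * h z + b * g z + c) z = a * deriv h z + b * deriv g z"
    by (rule DERIV_imp_deriv) (auto intro!: derivative_eq_intros d)
  moreover have "deriv (\<lambda>z. cnj a * g z + cnj b * h z) z = cnj a * deriv g z + cnj b * deriv h z"
    by (rule DERIV_imp_deriv) (auto intro!: derivative_eq_intros d)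
  moreover have "cnj a * (deriv g z / deriv h z) + cnj b = (cnj a * deriv g z + cnj b * deriv h z) / deriv h z"
    "a + b * (deriv g z / deriv h z) = (a * deriv h z + b * deriv g z) / deriv h z"
    using nz by (simp_all add: add_divide_distrib)
  ultimately show ?thesis
    using nz by (simp add: dilatation_eq[OF affine_analytic_parts[OF hg] z] dilatation_eq[OF hg z] mobius_def)
qed

lemma affine_dilatation_range:
  assumes f: "op_harmonic f" "sup_norm (dilatation f) < 1" and ab: "cmod b < cmod a"
  shows "closure (dilatation ((\<lambda>w. a * w + b * cnj w + c) \<circ> f) ` unit_disk)
       = mobius a b ` closure (dilatation f ` unit_disk)"
proof -
  have "dilatation ((\<lambda>w. a * w + b * cnj w + c) \<circ> f) ` unit_disk = mobius a b ` (dilatation f ` unit_disk)"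
    unfolding image_image by (rule image_cong[OF refl affine_dilatation[OF f(1)]])
  then show ?thesis
    using closure_continuous_image_compact[OF dilatation_range(1)[OF f]
        continuous_on_mobius[OF ab dilatation_range(3)[OF f]]] by simp
qed

text \<open>The affine mapping \<open>\<lambda>w. w - cnj c * cnj w\<close> acts on the dilatation
  by the automorphism that moves the circumcenter \<open>c\<close> to 0. Its existence gives the
  choice in \<open>balanced_rep\<close> its defining property.\<close>

lemma ex_balancing_affine:
  assumes f: "op_harmonic f" "sup_norm (dilatation f) < 1"
  shows "\<exists>A. op_real_affine A \<and> c_aff (A \<circ> f) = 0"
proof -
  let ?E = "closure (dilatation f ` unit_disk)"
  note E = dilatation_range[OF f]
  define c where "c = circumcenter ?E"
  have c: "is_circumcenter ?E c"
    unfolding c_def by (rule is_circumcenter_circumcenter[OF E])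
  then have lt: "cmod (- cnj c) < cmod 1" by (simp add: is_circumcenter_def)
  let ?A = "\<lambda>w. 1 * w + (- cnj c) * cnj w + 0"
  have "c_aff (?A \<circ> f) = circumcenter (mobius 1 (- cnj c) ` ?E)"
    unfolding c_aff_def affine_dilatation_range[OF f lt] ..
  also have "\<dots> = mobius 1 (- cnj c) c"
    by (rule circumcenter_eqI[OF mobius_image[OF lt E] is_circumcenter_mobius[OF lt E(3) c]])
  also have "\<dots> = 0" by (rule mobius_centering)
  finally show ?thesis using lt unfolding op_real_affine_def by blast
qed

text \<open>This joins the two halves: Jung's inequality supplies the dilatation bound for
  \<open>A \<circ> f\<close>, and the normalized parts form a pair to which
  \<open>qc_pair_compact\<close> applies.\<close>

lemma balanced_rep_analytic_parts:
  assumes "0 \<le> D" and f: "f \<in> harmonic_class D"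
  shows "\<exists>H G. analytic_parts (balanced_rep f) H G \<and> qc_pair (k_const D) unit_disk H G \<and>
           H 0 = 0 \<and> G 0 = 0 \<and> deriv H 0 = 1"
proof -
  have f': "op_harmonic f" "univalent f" "sup_norm (dilatation f) < 1" "d_aff f \<le> D"
    using f by (auto simp: harmonic_class_def)
  let ?E = "closure (dilatation f ` unit_disk)"
  note E = dilatation_range[OF f'(1,3)]
  \<comment> \<open>Only the two chosen properties of \<open>A\<close> enter, so the conclusion
    holds whichever mapping is selected.\<close>
  define A where "A = (SOME A. op_real_affine A \<and> c_aff (A \<circ> f) = 0)"
  have A: "op_real_affine A" "c_aff (A \<circ> f) = 0"
    using someI_ex[OF ex_balancing_affine[OF f'(1,3)]] by (auto simp: A_def)
  obtain a b c where ab: "cmod b < cmod a" and Aeq: "A = (\<lambda>w. a * w + b * cnj w + c)"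
    using A(1) unfolding op_real_affine_def by blast
  note E' = mobius_image[OF ab E]
  have range: "closure (dilatation (A \<circ> f) ` unit_disk) = mobius a b ` ?E"
    unfolding Aeq by (rule affine_dilatation_range[OF f'(1,3) ab])
  have "circumcenter (mobius a b ` ?E) = 0"
    using A(2) by (simp add: c_aff_def range)
  with is_circumcenter_circumcenter[OF E'] have circ: "is_circumcenter (mobius a b ` ?E) 0" by simp
  have diam: "hyp_dist z w \<le> D" if zw: "z \<in> mobius a b ` ?E" "w \<in> mobius a b ` ?E" for z w
  proof -
    from zw obtain x y where xy: "x \<in> ?E" "y \<in> ?E" "z = mobius a b x" "w = mobius a b y" by blast
    have "hyp_dist z w = hyp_dist x y"
      unfolding xy(3,4) by (rule hyp_dist_mobius[OF ab]) (use xy E(3) in blast)+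
    also have "\<dots> \<le> d_aff f"
      unfolding d_aff_def by (rule hyp_dist_le_diameter[OF E(1,3) xy(1,2)])
    finally show ?thesis using f'(4) by simp
  qed
  have dil: "cmod (dilatation (A \<circ> f) z) \<le> k_const D" if "z \<in> unit_disk" for z
  proof -
    have "dilatation (A \<circ> f) z \<in> closure (dilatation (A \<circ> f) ` unit_disk)"
      by (rule subsetD[OF closure_subset imageI[OF that]])
    then have in_range: "dilatation (A \<circ> f) z \<in> mobius a b ` ?E" unfolding range .
    show ?thesis
      by (rule Jung_at_circumcenter_0[OF E' circ \<open>0 \<le> D\<close> _ in_range]) (rule diam)
  qed
  obtain h g where hg: "analytic_parts f h g" and nz: "\<And>z. z \<in> unit_disk \<Longrightarrow> deriv h z \<noteq> 0"
    and lt1: "\<And>z. z \<in> unit_disk \<Longrightarrow> cmod (dilatation f z) < 1"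
    by (rule op_harmonicE[OF f'(1)]) blast
  define h1 where "h1 = (\<lambda>z. a * h z + b * g z + c)"
  define g1 where "g1 = (\<lambda>z. cnj a * g z + cnj b * h z)"
  have parts: "analytic_parts (A \<circ> f) h1 g1"
    unfolding Aeq h1_def g1_def by (rule affine_analytic_parts[OF hg])
  have nz1: "deriv h1 z \<noteq> 0" if z: "z \<in> unit_disk" for z
  proof -
    have d: "(h has_field_derivative deriv h z) (at z)" "(g has_field_derivative deriv g z) (at z)"
      using hg z by (auto simp: analytic_parts_def intro!: holomorphic_derivI[OF _ open_ball])
    have "deriv h1 z = a * deriv h z + b * deriv g z"
      unfolding h1_def by (rule DERIV_imp_deriv) (auto intro!: derivative_eq_intros d)
    also have "\<dots> = deriv h z * (a + b * dilatation f z)"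
      using nz[OF z] by (simp add: dilatation_eq[OF hg z] algebra_simps)
    finally show ?thesis
      using nz[OF z] mobius_denominator_nonzero[OF ab, of "dilatation f z"] lt1[OF z] by simp
  qed
  have "inj A"
  proof (rule injI)
    fix x y assume "A x = A y"
    moreover obtain T where "\<And>x. T (a * x + cnj (cnj b * x)) = x"
      using orientation_preserving_linear_inverse[of "cnj b" a] ab by auto
    ultimately show "x = y" unfolding Aeq by (metis add_right_cancel complex_cnj_cnj complex_cnj_mult)
  qed
  have "inj_on (A \<circ> f) unit_disk"
    using f'(2) \<open>inj A\<close> by (intro comp_inj_on) (auto intro: inj_on_subset)
  then have "inj_on (\<lambda>z. h1 z + cnj (g1 z)) unit_disk"
    by (rule inj_on_cong[THEN iffD1, rotated]) (use parts in \<open>simp add: analytic_parts_def\<close>)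
  moreover have "cmod (deriv g1 z) \<le> k_const D * cmod (deriv h1 z)" if "z \<in> unit_disk" for z
    using dil[OF that] nz1[OF that] by (simp add: dilatation_eq[OF parts that] norm_divide divide_le_eq)
  ultimately have qc1: "qc_pair (k_const D) unit_disk h1 g1"
    using parts nz1 by (auto simp: qc_pair_def analytic_parts_def)
  define l where "l = deriv h1 0"
  have l: "l \<noteq> 0" using nz1[of 0] by (simp add: l_def)
  have wl: "wirtinger (A \<circ> f) 0 = l"
    unfolding l_def by (rule wirtinger_analytic_parts[OF parts]) simp
  \<comment> \<open>Written as a rescaling with center 0 and factor 1, so that
    \<open>qc_pair_rescale\<close> covers the normalization.\<close>
  define H where "H = (\<lambda>z. (h1 (0 + of_real 1 * z) - h1 0) / l)"
  define G where "G = (\<lambda>z. (g1 (0 + of_real 1 * z) - g1 0) / cnj l)"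
  have qc: "qc_pair (k_const D) unit_disk H G"
    unfolding H_def G_def by (rule qc_pair_rescale(1)[OF qc1 open_ball open_ball zero_less_one l]) simp
  have dH: "deriv H 0 = of_real 1 * deriv h1 (0 + of_real 1 * 0) / l"
    unfolding H_def by (rule qc_pair_rescale(2)[OF qc1 open_ball open_ball[of 0 1] zero_less_one l]) auto
  have "balanced_rep f z = H z + cnj (G z)" if z: "z \<in> unit_disk" for z
  proof -
    have "A (f z) = h1 z + cnj (g1 z)" "A (f 0) = h1 0 + cnj (g1 0)"
      using parts z by (auto simp: analytic_parts_def)
    then show ?thesis
      by (simp add: balanced_rep_def Let_def wl H_def G_def add_divide_distrib diff_divide_distrib flip: A_def)
  qed
  then have "analytic_parts (balanced_rep f) H G"
    using qc by (auto simp: analytic_parts_def qc_pair_def)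
  moreover have "H 0 = 0" "G 0 = 0" by (simp_all add: H_def G_def)
  moreover have "deriv H 0 = 1" unfolding dH using l by (simp add: l_def)
  ultimately show ?thesis using qc by blast
qed

section \<open>Conclusions for harmonic mappings\<close>

lemma qc_pair_harmonic:
  assumes parts: "analytic_parts F H G" and qc: "qc_pair k unit_disk H G" and "k < 1"
  shows "op_harmonic F" "univalent F"
    and "analytic_parts F H' G' \<Longrightarrow> sup_norm (\<lambda>z. deriv G' z / deriv H' z) \<le> k"
    and "sup_norm (dilatation F) \<le> k"
proof -
  have bd: "deriv H z \<noteq> 0" "cmod (deriv G z) \<le> k * cmod (deriv H z)" if "z \<in> unit_disk" for z
    using qc that by (auto simp: qc_pair_def)
  have "0 < (cmod (deriv H z))\<^sup>2 - (cmod (deriv G z))\<^sup>2" if z: "z \<in> unit_disk" for z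
  proof -
    have "cmod (deriv G z) < cmod (deriv H z)"
      using bd[OF z] \<open>k < 1\<close> by (smt (verit) mult_less_cancel_right2 zero_less_norm_iff)
    then show ?thesis by (simp add: power_strict_mono)
  qed
  with parts show "op_harmonic F" unfolding op_harmonic_def by blast
  have "inj_on (\<lambda>z. H z + cnj (G z)) unit_disk" using qc by (simp add: qc_pair_def)
  then show "univalent F"
    by (rule inj_on_cong[THEN iffD1, rotated]) (use parts in \<open>simp add: analytic_parts_def\<close>)
  have quot: "cmod (deriv G z / deriv H z) \<le> k" if "z \<in> unit_disk" for z
    using bd[OF that] by (simp add: norm_divide divide_le_eq)
  show "sup_norm (\<lambda>z. deriv G' z / deriv H' z) \<le> k" if "analytic_parts F H' G'"
    unfolding sup_norm_def
    by (rule cSUP_least) (use quot analytic_parts_deriv_unique[OF parts that] in auto)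
  show "sup_norm (dilatation F) \<le> k"
    unfolding sup_norm_def
    by (rule cSUP_least) (use quot dilatation_eq[OF parts] in auto)
qed

lemma locally_uniform_limit_compact:
  assumes "open S"
    and lim: "\<And>K. compact K \<Longrightarrow> K \<subseteq> S \<Longrightarrow> uniform_limit K u l sequentially"
  shows "locally_uniform_limit S u l"
  unfolding locally_uniform_limit_def
proof
  fix x assume "x \<in> S"
  then obtain e where e: "e > 0" "cball x e \<subseteq> S"
    using \<open>open S\<close> by (meson open_contains_cball)
  have "uniform_limit (ball x e \<inter> S) u l sequentially"
    by (rule uniform_limit_on_subset[OF lim[OF compact_cball e(2)]]) auto
  with e(1) show "\<exists>e>0. uniform_limit (ball x e \<inter> S) u l sequentially" by blast
qed

theorem theorem8p4:
  fixes D :: real and f F :: "nat \<Rightarrow> complex \<Rightarrow> complex"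
  assumes "0 \<le> D"
    and "\<And>n. f n \<in> harmonic_class D"
    and "\<And>n. F n = balanced_rep (f n)"
  shows "normal_family unit_disk (range F) \<and>
    k_const D < 1 \<and>
    (\<forall>n. op_harmonic (F n) \<and>
       (\<forall>H G. analytic_parts (F n) H G \<longrightarrow>
          sup_norm (\<lambda>z. deriv G z / deriv H z) \<le> k_const D)) \<and>
    (\<forall>\<sigma> :: nat \<Rightarrow> nat. \<exists>r L. strict_mono (r :: nat \<Rightarrow> nat) \<and>
       locally_uniform_limit unit_disk (\<lambda>m. F (\<sigma> (r m))) L \<and>
       op_harmonic L \<and> univalent L \<and> L 0 = 0 \<and> wirtinger L 0 = 1 \<and>
       sup_norm (dilatation L) < 1 \<and>
       qc_constant L \<le> (1 + k_const D) / (1 - k_const D))"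
proof -
  note k = k_const_less_1[of D]
  have "\<exists>H G. analytic_parts (F n) H G \<and> qc_pair (k_const D) unit_disk H G \<and>
           H 0 = 0 \<and> G 0 = 0 \<and> deriv H 0 = 1" for n
    unfolding assms(3) by (rule balanced_rep_analytic_parts[OF assms(1,2)])
  then obtain H G where parts: "\<And>n. analytic_parts (F n) (H n) (G n)"
    and qc: "\<And>n. qc_pair (k_const D) unit_disk (H n) (G n)"
    and norm: "\<And>n. H n 0 = 0" "\<And>n. G n 0 = 0" "\<And>n. deriv (H n) 0 = 1"
    by metis
  \<comment> \<open>The index map \<open>\<sigma>\<close> is arbitrary, not necessarily increasing,
    since a sequence in the family may repeat or reorder its members. Normality then follows by
    choosing an index for each term.\<close>
  have limits: "\<exists>r L. strict_mono (r :: nat \<Rightarrow> nat) \<and>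
       locally_uniform_limit unit_disk (\<lambda>m. F (\<sigma> (r m))) L \<and>
       op_harmonic L \<and> univalent L \<and> L 0 = 0 \<and> wirtinger L 0 = 1 \<and>
       sup_norm (dilatation L) < 1 \<and>
       qc_constant L \<le> (1 + k_const D) / (1 - k_const D)" for \<sigma> :: "nat \<Rightarrow> nat"
  proof -
    obtain r H0 G0 where r: "strict_mono (r :: nat \<Rightarrow> nat)"
      and qc0: "qc_pair (k_const D) unit_disk H0 G0"
      and norm0: "H0 0 = 0" "G0 0 = 0" "deriv H0 0 = 1"
      and lim: "\<And>K. compact K \<Longrightarrow> K \<subseteq> unit_disk \<Longrightarrow> uniform_limit K (\<lambda>n. H (\<sigma> (r n))) H0 sequentially"
        "\<And>K. compact K \<Longrightarrow> K \<subseteq> unit_disk \<Longrightarrow> uniform_limit K (\<lambda>n. G (\<sigma> (r n))) G0 sequentially"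
      by (rule qc_pair_compact[OF k, of "\<lambda>n. H (\<sigma> n)" "\<lambda>n. G (\<sigma> n)"]) (use qc norm in blast)+
    define L where "L = (\<lambda>z. H0 z + cnj (G0 z))"
    have partsL: "analytic_parts L H0 G0"
      using qc0 by (auto simp: analytic_parts_def qc_pair_def L_def)
    note L = qc_pair_harmonic[OF partsL qc0 k]
    have "locally_uniform_limit unit_disk (\<lambda>m. F (\<sigma> (r m))) L"
    proof (rule locally_uniform_limit_compact[OF open_ball])
      fix K :: "complex set" assume K: "compact K" "K \<subseteq> unit_disk"
      have "uniform_limit K (\<lambda>n z. H (\<sigma> (r n)) z + cnj (G (\<sigma> (r n)) z)) L sequentially"
        unfolding L_def by (intro uniform_limit_add lim K bounded_linear.uniform_limit[OF bounded_linear_cnj])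
      then show "uniform_limit K (\<lambda>m. F (\<sigma> (r m))) L sequentially"
        by (rule uniform_limit_cong'[THEN iffD1, rotated 2])
          (use parts K(2) in \<open>auto simp: analytic_parts_def\<close>)
    qed
    moreover have "L 0 = 0" by (simp add: L_def norm0)
    moreover have "wirtinger L 0 = 1"
      using wirtinger_analytic_parts[OF partsL] norm0 by simp
    moreover have "sup_norm (dilatation L) < 1" using L(4) k by simp
    moreover have "qc_constant L \<le> (1 + k_const D) / (1 - k_const D)"
      unfolding qc_constant_def using L(4) k by (simp add: one_plus_div_one_minus_le_iff)
    ultimately show ?thesis using r L(1,2) by blast
  qed
  have "normal_family unit_disk (range F)"
    unfolding normal_family_def
  proof (intro allI impI)
    fix s :: "nat \<Rightarrow> complex \<Rightarrow> complex" assume "range s \<subseteq> range F"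
    then have "\<forall>m. \<exists>n. s m = F n" by blast
    then obtain \<sigma> where \<sigma>: "\<And>m. s m = F (\<sigma> m)" by metis
    show "\<exists>r l. strict_mono (r :: nat \<Rightarrow> nat) \<and> locally_uniform_limit unit_disk (\<lambda>m. s (r m)) l"
      using limits[of \<sigma>] unfolding \<sigma> by blast
  qed
  then show ?thesis
    using limits qc_pair_harmonic[OF parts qc k] k by blast
qed

end
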